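(* Let $\mathcal{G}$, $p_{ij}$, $w_{ij}$ and $\epsilon>0$ be as in the context. The gossip algorithm achieves mean-square average consensus if and only if $1$ is a simple eigenvalue of the matrix $E[M\otimes M]:=\sum_{(j,i)\in\mathcal{E}}p_{ij}\,M_{ji}\otimes M_{ji}$ and all other eigenvalues of $E[M\otimes M]$ have modulus strictly smaller than one.
   Context: Setting: $\mathcal{G}=(\mathcal{V},\mathcal{E})$ is a digraph with $\mathcal{V}=\{1,\dots,n\}$, $n>1$, and no selfloops. To each edge $(j,i)\in\mathcal{E}$ are assigned a probability $p_{ij}\in(0,1)$, with $\sum_{(j,i)\in\mathcal{E}}p_{ij}=1$, and a weight $w_{ij}\in(0,1)$. Notation: $f_i$ is the $i$-th standard basis vector of $\mathbb{R}^n$, and $\otimes$ is the Kronecker product. For each edge $(j,i)$ let $D_{ji}=w_{ij}f_if_i^T$, $L_{ji}=D_{ji}-w_{ij}f_if_j^T$, $S_{ji}=I-(f_j-f_i)f_j^T$, and $$M_{ji}=\begin{bmatrix} I-L_{ji} & \epsilon D_{ji}\\ L_{ji} & S_{ji}-\epsilon D_{ji}\end{bmatrix}.$$ Gossip algorithm: $(x(k+1),s(k+1))^T=M(k)(x(k),s(k))^T$, where $M(k)$ are i.i.d. and $M(k)=M_{ji}$ with probability $p_{ij}$. The initial condition is $s(0)=0$ with $x(0)$ arbitrary. Mean-square average consensus: for every $x(0)$, $E[\|x(k)-x_a\mathbf{1}\|_2^2]\to0$ and $E[\|s(k)\|_2^2]\to0$, where $x_a=\mathbf{1}^Tx(0)/n$.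 *)

theory Defs
  imports "Jordan_Normal_Form.Matrix" "Jordan_Normal_Form.Char_Poly"
begin

text \<open>Vertices are 0,...,n-1 (instead of 1,...,n). An edge (j,i) carries probability p i j
  and weight w i j.\<close>

definition outer :: "real vec \<Rightarrow> real vec \<Rightarrow> real mat" where
  "outer u v = mat (dim_vec u) (dim_vec v) (\<lambda>(a,b). u $ a * v $ b)"

definition kron :: "real mat \<Rightarrow> real mat \<Rightarrow> real mat" where
  "kron A B = mat (dim_row A * dim_row B) (dim_col A * dim_col B)
     (\<lambda>(r,c). A $$ (r div dim_row B, c div dim_col B) * B $$ (r mod dim_row B, c mod dim_col B))"

definition fv :: "nat \<Rightarrow> nat \<Rightarrow> real vec" where
  "fv n i = unit_vec n i"

definition Dm :: "nat \<Rightarrow> (nat \<Rightarrow> nat \<Rightarrow> real) \<Rightarrow> nat \<Rightarrow> nat \<Rightarrow> real mat" where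
  "Dm n w j i = w i j \<cdot>\<^sub>m outer (fv n i) (fv n i)"

definition Lm :: "nat \<Rightarrow> (nat \<Rightarrow> nat \<Rightarrow> real) \<Rightarrow> nat \<Rightarrow> nat \<Rightarrow> real mat" where
  "Lm n w j i = Dm n w j i - w i j \<cdot>\<^sub>m outer (fv n i) (fv n j)"

definition Sm :: "nat \<Rightarrow> nat \<Rightarrow> nat \<Rightarrow> real mat" where
  "Sm n j i = 1\<^sub>m n - outer (fv n j - fv n i) (fv n j)"

definition Mm :: "nat \<Rightarrow> (nat \<Rightarrow> nat \<Rightarrow> real) \<Rightarrow> real \<Rightarrow> nat \<Rightarrow> nat \<Rightarrow> real mat" where
  "Mm n w \<epsilon> j i = four_block_mat
      (1\<^sub>m n - Lm n w j i)  (\<epsilon> \<cdot>\<^sub>m Dm n w j i)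
      (Lm n w j i)          (Sm n j i - \<epsilon> \<cdot>\<^sub>m Dm n w j i)"

definition EMM :: "nat \<Rightarrow> (nat \<times> nat) set \<Rightarrow> (nat \<Rightarrow> nat \<Rightarrow> real) \<Rightarrow> (nat \<Rightarrow> nat \<Rightarrow> real)
    \<Rightarrow> real \<Rightarrow> real mat" where
  "EMM n E p w \<epsilon> = mat (4*n*n) (4*n*n)
     (\<lambda>rc. \<Sum>(j,i)\<in>E. p i j * kron (Mm n w \<epsilon> j i) (Mm n w \<epsilon> j i) $$ rc)"

fun run :: "nat \<Rightarrow> (nat \<Rightarrow> nat \<Rightarrow> real) \<Rightarrow> real \<Rightarrow> (nat \<times> nat) list \<Rightarrow> real vec \<Rightarrow> real vec" where
  "run n w \<epsilon> [] z = z"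
| "run n w \<epsilon> ((j,i) # es) z = run n w \<epsilon> es (Mm n w \<epsilon> j i *\<^sub>v z)"

definition xpart :: "nat \<Rightarrow> real vec \<Rightarrow> real vec" where
  "xpart n z = vec n (\<lambda>a. z $ a)"

definition spart :: "nat \<Rightarrow> real vec \<Rightarrow> real vec" where
  "spart n z = vec n (\<lambda>a. z $ (n + a))"

definition sqnorm :: "real vec \<Rightarrow> real" where
  "sqnorm v = (\<Sum>a<dim_vec v. (v $ a)\<^sup>2)"

text \<open>Probability of a particular sequence of i.i.d. edge choices.\<close>
definition seq_prob :: "(nat \<Rightarrow> nat \<Rightarrow> real) \<Rightarrow> (nat \<times> nat) list \<Rightarrow> real" where
  "seq_prob p es = prod_list (map (\<lambda>(j,i). p i j) es)"

definition seqs :: "(nat \<times> nat) set \<Rightarrow> nat \<Rightarrow> (nat \<times> nat) list set" where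
  "seqs E k = {es. set es \<subseteq> E \<and> length es = k}"

definition init :: "nat \<Rightarrow> real vec \<Rightarrow> real vec" where
  "init n x0 = x0 @\<^sub>v 0\<^sub>v n"

definition xavg :: "nat \<Rightarrow> real vec \<Rightarrow> real" where
  "xavg n x0 = (\<Sum>a<n. x0 $ a) / real n"

definition Ex_err :: "nat \<Rightarrow> (nat \<times> nat) set \<Rightarrow> (nat \<Rightarrow> nat \<Rightarrow> real) \<Rightarrow> (nat \<Rightarrow> nat \<Rightarrow> real)
    \<Rightarrow> real \<Rightarrow> real vec \<Rightarrow> nat \<Rightarrow> real" where
  "Ex_err n E p w \<epsilon> x0 k = (\<Sum>es\<in>seqs E k. seq_prob p es *
      sqnorm (xpart n (run n w \<epsilon> es (init n x0)) - xavg n x0 \<cdot>\<^sub>v vec n (\<lambda>_. 1)))"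

definition Es_err :: "nat \<Rightarrow> (nat \<times> nat) set \<Rightarrow> (nat \<Rightarrow> nat \<Rightarrow> real) \<Rightarrow> (nat \<Rightarrow> nat \<Rightarrow> real)
    \<Rightarrow> real \<Rightarrow> real vec \<Rightarrow> nat \<Rightarrow> real" where
  "Es_err n E p w \<epsilon> x0 k = (\<Sum>es\<in>seqs E k. seq_prob p es *
      sqnorm (spart n (run n w \<epsilon> es (init n x0))))"

definition ms_consensus :: "nat \<Rightarrow> (nat \<times> nat) set \<Rightarrow> (nat \<Rightarrow> nat \<Rightarrow> real) \<Rightarrow> (nat \<Rightarrow> nat \<Rightarrow> real)
    \<Rightarrow> real \<Rightarrow> bool" where
  "ms_consensus n E p w \<epsilon> \<longleftrightarrow> (\<forall>x0 :: real vec. dim_vec x0 = n \<longrightarrow>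
      (Ex_err n E p w \<epsilon> x0 \<longlonglongrightarrow> 0) \<and> (Es_err n E p w \<epsilon> x0 \<longlonglongrightarrow> 0))"

end

theory Submission
  imports Defs "Jordan_Normal_Form.Spectral_Radius" "HOL-Analysis.L2_Norm"
begin

text \<open>
  Write \<open>A = E[M \<otimes> M]\<close> and \<open>v = (1, 0)\<close>. Every \<open>M\<^sub>j\<^sub>i\<close> fixes \<open>v\<close> and preserves the sum of all
  coordinates, so \<open>A\<close> has the right eigenvector \<open>v \<otimes> v\<close> and the left eigenvector \<open>1 \<otimes> 1\<close> for the
  eigenvalue 1. Subtracting the corresponding rank-one projection \<open>P\<close> replaces one eigenvalue 1 by 0,
  so the spectral condition says that \<open>A - P\<close> has spectral radius below 1, i.e. that \<open>A\<^sup>k\<close> tends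
  to \<open>P\<close>. Since \<open>A\<^sup>k (a \<otimes> b)\<close> collects the mixed second moments of the runs from \<open>a\<close> and \<open>b\<close>,
  this convergence gives mean-square decay from every initial vector with coordinate sum 0.

  Conversely, the vectors from which the second moments decay form a subspace that is invariant under
  every \<open>M\<^sub>j\<^sub>i\<close>. Under consensus each vertex \<open>i\<close> has an incoming edge (otherwise \<open>x\<^sub>i\<close> never moves), and
  one step along it shows that \<open>(-f\<^sub>i, f\<^sub>i)\<close> lies in the subspace. Hence the subspace contains every
  vector with coordinate sum 0, and Cauchy-Schwarz bounds the mixed moments, so \<open>A\<^sup>k\<close> tends to \<open>P\<close>.
\<close>

section \<open>Powers of a matrix with a simple dominant eigenvalue 1\<close>

text \<open>Both sides are the determinant of the bordered matrix \<open>[[xI - A, -V], [R, 1]]\<close>,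
  cleared by column operations in two ways, times \<open>x - 1\<close>.\<close>
lemma det_deflate:
  fixes A :: "'a :: idom mat"
  assumes A: "A \<in> carrier_mat n n" and V: "V \<in> carrier_mat n 1" and R: "R \<in> carrier_mat 1 n"
    and AV: "A * V = V" and RV: "R * V = 1\<^sub>m 1"
  shows "x * det (x \<cdot>\<^sub>m 1\<^sub>m n - A) = (x - 1) * det (x \<cdot>\<^sub>m 1\<^sub>m n - (A - V * R))"
proof -
  let ?X = "x \<cdot>\<^sub>m 1\<^sub>m n - A"
  define C where "C = four_block_mat ?X (- V) R (1\<^sub>m 1)"
  define C1 where "C1 = four_block_mat (1\<^sub>m n) (0\<^sub>m n 1) (- R) (1\<^sub>m 1)"
  \<comment> \<open>The corner entry \<open>x - 1\<close> is the eigenvalue of \<open>?X\<close> at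
    \<open>V\<close>; with it, multiplication by \<open>C2\<close> cancels the upper right block of
    \<open>C\<close>.\<close>
  define C2 where "C2 = four_block_mat (1\<^sub>m n) V (0\<^sub>m 1 n) ((x - 1) \<cdot>\<^sub>m 1\<^sub>m 1)"
  have X: "?X \<in> carrier_mat n n" using A by auto
  have c: "C \<in> carrier_mat (n+1) (n+1)" "C1 \<in> carrier_mat (n+1) (n+1)" "C2 \<in> carrier_mat (n+1) (n+1)"
    unfolding C_def C1_def C2_def by (intro four_block_carrier_mat X; simp)+
  have XV: "?X * V = (x - 1) \<cdot>\<^sub>m V"
  proof -
    have "?X * V = (x \<cdot>\<^sub>m 1\<^sub>m n) * V - A * V"
      by (rule minus_mult_distrib_mat[OF _ A V]) auto
    also have "(x \<cdot>\<^sub>m 1\<^sub>m n) * V = x \<cdot>\<^sub>m V"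
      using V by (simp add: mult_smult_assoc_mat[of _ n n _ 1])
    finally show ?thesis unfolding AV
      by (intro eq_matI) (use V in \<open>auto simp: algebra_simps\<close>)
  qed
  have VR: "V * R \<in> carrier_mat n n" using V R by auto
  have "C * C1 = four_block_mat (x \<cdot>\<^sub>m 1\<^sub>m n - (A - V * R)) (- V) (0\<^sub>m 1 n) (1\<^sub>m 1)"
    unfolding C_def C1_def
  proof (subst mult_four_block_mat[of _ n n _ 1 _ 1], goal_cases)
    case 9
    have 1: "?X * 1\<^sub>m n + - V * - R = x \<cdot>\<^sub>m 1\<^sub>m n - (A - V * R)"
      using V R A right_mult_one_mat[OF X] by (intro eq_matI) auto
    have 2: "?X * 0\<^sub>m n 1 + - V * 1\<^sub>m 1 = - V"
      using V X by (simp add: right_mult_zero_mat[OF X])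
    have 3: "R * 1\<^sub>m n + 1\<^sub>m 1 * - R = 0\<^sub>m 1 n"
      using R by (intro eq_matI) auto
    have 4: "R * 0\<^sub>m n 1 + 1\<^sub>m 1 * 1\<^sub>m 1 = 1\<^sub>m 1" using R by simp
    show ?case unfolding 1 2 3 4 ..
  qed (use V R X in auto)
  moreover have "det \<dots> = det (x \<cdot>\<^sub>m 1\<^sub>m n - (A - V * R))"
    by (subst det_four_block_mat_lower_left_zero[of _ n _ 1]) (use V R A in auto)
  moreover have "det C1 = 1" unfolding C1_def
    by (subst det_four_block_mat_upper_right_zero[of _ n _ 1]) (use R in auto)
  ultimately have 1: "det C = det (x \<cdot>\<^sub>m 1\<^sub>m n - (A - V * R))"
    using det_mult[OF c(1,2)] by simp
  have "C * C2 = four_block_mat ?X (0\<^sub>m n 1) R (x \<cdot>\<^sub>m 1\<^sub>m 1)"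
    unfolding C_def C2_def
  proof (subst mult_four_block_mat[of _ n n _ 1 _ 1], goal_cases)
    case 9
    have 1: "?X * 1\<^sub>m n + - V * 0\<^sub>m 1 n = ?X"
      using V right_mult_one_mat[OF X] X by simp
    have 2: "?X * V + - V * ((x - 1) \<cdot>\<^sub>m 1\<^sub>m 1) = 0\<^sub>m n 1"
      unfolding XV using V by (intro eq_matI) (auto simp: mult_smult_distrib[of _ n 1 _ 1])
    have 3: "R * 1\<^sub>m n + 1\<^sub>m 1 * 0\<^sub>m 1 n = R"
      using R by simp
    have 4: "R * V + 1\<^sub>m 1 * ((x - 1) \<cdot>\<^sub>m 1\<^sub>m 1) = x \<cdot>\<^sub>m 1\<^sub>m 1" 
      unfolding RV by (intro eq_matI) auto
    show ?case unfolding 1 2 3 4 ..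
  qed (use V R X in auto)
  moreover have "det \<dots> = det ?X * x"
    by (subst det_four_block_mat_upper_right_zero[of _ n _ 1]) (use V R A in auto)
  moreover have "det C2 = x - 1" unfolding C2_def
    by (subst det_four_block_mat_lower_left_zero[of _ n _ 1]) (use V in auto)
  ultimately have "det C * (x - 1) = det ?X * x"
    using det_mult[OF c(1,3)] by simp
  with 1 show ?thesis by (simp add: mult.commute)
qed

text \<open>The determinant identity holds at every point of an infinite field, hence between
  polynomials. Deflation thus trades one root 1 for a root 0.\<close>

lemma char_poly_deflate:
  fixes A :: "'a :: field_char_0 mat"
  assumes A: "A \<in> carrier_mat n n" and V: "V \<in> carrier_mat n 1" and R: "R \<in> carrier_mat 1 n"
    and AV: "A * V = V" and RV: "R * V = 1\<^sub>m 1"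
  shows "[:0, 1:] * char_poly A = [:-1, 1:] * char_poly (A - V * R)"
proof -
  have eq: "poly (char_poly M) x = det (x \<cdot>\<^sub>m 1\<^sub>m n - M)" if "M \<in> carrier_mat n n" for M :: "'a mat" and x
    unfolding char_poly_matrix[OF that]
    by (rule arg_cong[of _ _ det], intro eq_matI) (use that in \<open>auto simp: char_matrix_def\<close>)
  have B: "A - V * R \<in> carrier_mat n n" using A V R by auto
  have "poly ([:0, 1:] * char_poly A) x = poly ([:-1, 1:] * char_poly (A - V * R)) x" for x
    using det_deflate[OF assms, of x] eq[OF A] eq[OF B] by (simp add: left_diff_distrib)
  then show ?thesis
    by (intro poly_eq_poly_eq_iff[THEN iffD1]) auto
qed

text \<open>The projection \<open>P = V * R\<close> is idempotent and absorbs \<open>A\<close> from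
  either side, so all products with \<open>P\<close> in \<open>(A^k - P)(A - P)\<close> equal
  \<open>P\<close>. Exponents start at 1, since at exponent 0 the left side is the identity.\<close>

lemma pow_mat_deflate:
  fixes A :: "'a :: comm_ring_1 mat"
  assumes A: "A \<in> carrier_mat n n" and V: "V \<in> carrier_mat n 1" and R: "R \<in> carrier_mat 1 n"
    and AV: "A * V = V" and RA: "R * A = R" and RV: "R * V = 1\<^sub>m 1"
  shows "(A - V * R) ^\<^sub>m Suc k = A ^\<^sub>m Suc k - V * R"
proof (induction k)
  case 0
  show ?case using A V R by simp
next
  case (Suc k)
  let ?P = "V * R" and ?Ak = "A ^\<^sub>m Suc k"
  have P: "?P \<in> carrier_mat n n" and Ak: "?Ak \<in> carrier_mat n n" using A V R pow_carrier_mat[OF A] by auto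
  have AkV: "A ^\<^sub>m m * V = V" for m
  proof (induction m)
    case 0 show ?case using A V by simp
  next
    case (Suc m)
    then show ?case using assoc_mult_mat[OF pow_carrier_mat[OF A, of m] A V] AV by simp
  qed
  have AkP: "?Ak * ?P = ?P" 
    using assoc_mult_mat[OF Ak V R] AkV[of "Suc k"] by simp
  have PA: "?P * A = ?P" using assoc_mult_mat[OF V R A] RA by simp
  have PP: "?P * ?P = ?P"
  proof -
    have "?P * ?P = V * (R * V * R)"
      using assoc_mult_mat[OF V R P] assoc_mult_mat[OF R V R] by simp
    then show ?thesis using R by (simp add: RV)
  qed
  have "(A - ?P) ^\<^sub>m Suc (Suc k) = (?Ak - ?P) * (A - ?P)"
    using Suc by simp
  also have "\<dots> = ?Ak * (A - ?P) - ?P * (A - ?P)"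
    by (rule minus_mult_distrib_mat[OF Ak P minus_carrier_mat[OF P]])
  also have "?Ak * (A - ?P) = ?Ak * A - ?Ak * ?P"
    by (rule mult_minus_distrib_mat[OF Ak A P])
  also have "?P * (A - ?P) = ?P * A - ?P * ?P"
    by (rule mult_minus_distrib_mat[OF P A P])
  also have "?Ak * A - ?Ak * ?P - (?P * A - ?P * ?P) = A ^\<^sub>m Suc (Suc k) - ?P"
    unfolding AkP PA PP pow_mat.simps(2)[of A "Suc k"]
    using P mult_carrier_mat[OF Ak A] by (intro eq_matI) (simp_all del: index_mult_mat pow_mat.simps)
  finally show ?case .
qed

lemma pow_mat_smult:
  fixes A :: "'a :: comm_semiring_1 mat"
  assumes "A \<in> carrier_mat n n"
  shows "(c \<cdot>\<^sub>m A) ^\<^sub>m k = c ^ k \<cdot>\<^sub>m A ^\<^sub>m k"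
proof (induction k)
  case 0 show ?case using assms by (intro eq_matI) auto
next
  case (Suc k)
  have "(c \<cdot>\<^sub>m A) ^\<^sub>m Suc k = c ^ k \<cdot>\<^sub>m (A ^\<^sub>m k * (c \<cdot>\<^sub>m A))"
    using Suc mult_smult_assoc_mat[OF pow_carrier_mat[OF assms] smult_carrier_mat[OF assms]] by simp
  also have "A ^\<^sub>m k * (c \<cdot>\<^sub>m A) = c \<cdot>\<^sub>m (A ^\<^sub>m k * A)"
    by (rule mult_smult_distrib[OF pow_carrier_mat[OF assms] assms])
  finally show ?case by (intro eq_matI) (use assms in \<open>auto simp: ac_simps\<close>)
qed

text \<open>An eigenvalue of modulus at least 1 keeps its eigenvector from shrinking. Conversely,
  the Jordan form bound for spectral radius below 1 only yields bounded powers; applied to a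
  slightly enlarged multiple of \<open>A\<close>, it gives geometric decay for \<open>A\<close>
  itself.\<close>

lemma pow_mat_tendsto_0_iff:
  fixes A :: "complex mat"
  assumes A: "A \<in> carrier_mat n n"
  shows "(\<forall>i<n. \<forall>j<n. (\<lambda>k. (A ^\<^sub>m k) $$ (i,j)) \<longlonglongrightarrow> 0) \<longleftrightarrow> (\<forall>z. eigenvalue A z \<longrightarrow> cmod z < 1)"
    (is "?L \<longleftrightarrow> ?R")
proof
  assume L: ?L
  show ?R
  proof (intro allI impI, rule ccontr)
    fix z assume ev: "eigenvalue A z" and z: "\<not> cmod z < 1"
    then obtain v where v: "eigenvector A v z" by (auto simp: eigenvalue_def)
    then have vc: "v \<in> carrier_vec n" "v \<noteq> 0\<^sub>v n" using A by (auto simp: eigenvector_def)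
    then obtain i where i: "i < n" "v $ i \<noteq> 0" by (metis carrier_vecD eq_vecI index_zero_vec)
    have "(A ^\<^sub>m k *\<^sub>v v) $ i = (\<Sum>j<n. (A ^\<^sub>m k) $$ (i,j) * v $ j)" for k
      using i vc A by (simp add: scalar_prod_def lessThan_atLeast0)
    then have "z ^ k * v $ i = (\<Sum>j<n. (A ^\<^sub>m k) $$ (i,j) * v $ j)" for k
      using eigenvector_pow[OF A v] i vc by simp
    moreover have "(\<lambda>k. \<Sum>j<n. (A ^\<^sub>m k) $$ (i,j) * v $ j) \<longlonglongrightarrow> (\<Sum>j<n. 0 * v $ j)"
      using L i by (intro tendsto_sum tendsto_mult tendsto_const) auto
    ultimately have "(\<lambda>k. z ^ k * v $ i) \<longlonglongrightarrow> 0" by simp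
    then have "(\<lambda>k. cmod (z ^ k * v $ i)) \<longlonglongrightarrow> 0" by (rule tendsto_norm_zero)
    moreover have "cmod (v $ i) \<le> cmod (z ^ k * v $ i)" for k
      using z one_le_power[of "cmod z" k] by (simp add: norm_mult norm_power mult_le_cancel_right1)
    ultimately have "cmod (v $ i) \<le> 0"
      by (intro tendsto_lowerbound[of _ 0 sequentially]) auto
    then show False using i by simp
  qed
next
  assume R: ?R
  show ?L
  proof (intro allI impI)
    fix i j assume ij: "i < n" "j < n"
    then have n: "n > 0" by simp
    define \<rho> where "\<rho> = spectral_radius A"
    have "\<rho> \<in> cmod ` spectrum A" unfolding \<rho>_def by (rule spectral_radius_mem_max[OF A n])
    then have \<rho>: "0 \<le> \<rho>" "\<rho> < 1" using R by (auto simp: spectrum_def)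
    \<comment> \<open>With the midpoint between \<open>\<rho>\<close> and 1, \<open>A\<close>
      divided by \<open>s\<close> still has spectral radius below 1, and \<open>s ^ k\<close> tends
      to 0.\<close>
    define s where "s = (\<rho> + 1) / 2"
    have s: "\<rho> < s" "s < 1" "0 < s" using \<rho> by (auto simp: s_def)
    let ?c = "complex_of_real (1 / s)"
    have C: "?c \<cdot>\<^sub>m A \<in> carrier_mat n n" using A by simp
    have "spectral_radius (?c \<cdot>\<^sub>m A) < 1"
    proof -
      obtain z where z: "eigenvalue (?c \<cdot>\<^sub>m A) z" "spectral_radius (?c \<cdot>\<^sub>m A) = cmod z"
        using spectral_radius_mem_max(1)[OF C n] by (auto simp: spectrum_def)
      then obtain v where v: "v \<in> carrier_vec n" "v \<noteq> 0\<^sub>v n" "(?c \<cdot>\<^sub>m A) *\<^sub>v v = z \<cdot>\<^sub>v v"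
        using A by (auto simp: eigenvalue_def eigenvector_def)
      have "A *\<^sub>v v = (complex_of_real s * z) \<cdot>\<^sub>v v"
      proof (intro eq_vecI)
        fix i assume "i < dim_vec ((complex_of_real s * z) \<cdot>\<^sub>v v)"
        then have i: "i < n" using v by simp
        have "((?c \<cdot>\<^sub>m A) *\<^sub>v v) $ i = ?c * (A *\<^sub>v v) $ i"
          using i A v(1) by (simp add: scalar_prod_def sum_divide_distrib)
        with v(3) i v(1) have "z * v $ i = ?c * (A *\<^sub>v v) $ i" by simp
        then show "(A *\<^sub>v v) $ i = ((complex_of_real s * z) \<cdot>\<^sub>v v) $ i"
          using i v s by (simp add: field_simps)
      qed (use A v in auto)
      then have "eigenvalue A (complex_of_real s * z)"
        using v A by (auto simp: eigenvalue_def eigenvector_def)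
      then have "cmod (complex_of_real s * z) \<le> \<rho>"
        unfolding \<rho>_def by (intro spectral_radius_mem_max(2)[OF A n]) (auto simp: spectrum_def)
      then have "s * cmod z \<le> \<rho>" using s by (simp add: norm_mult)
      with s have "s * cmod z < s * 1" by linarith
      then show ?thesis using z s by (simp only: mult_less_cancel_left_pos)
    qed
    from spectral_radius_jnf_norm_bound_less_1_upper_triangular[OF C this]
    obtain b where b: "\<And>k. norm_bound ((?c \<cdot>\<^sub>m A) ^\<^sub>m k) b" by auto
    have bd: "cmod ((A ^\<^sub>m k) $$ (i,j)) \<le> b * s ^ k" for k
    proof -
      have "cmod (((?c \<cdot>\<^sub>m A) ^\<^sub>m k) $$ (i,j)) \<le> b"
        using b[of k] ij C unfolding norm_bound_def by (metis pow_mat_dim_square)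
      then have "cmod (?c ^ k * (A ^\<^sub>m k) $$ (i,j)) \<le> b"
        unfolding pow_mat_smult[OF A] using ij A by simp
      then show ?thesis using s by (simp add: norm_mult norm_power norm_divide field_simps)
    qed
    have "(\<lambda>k. b * s ^ k) \<longlonglongrightarrow> 0"
      using s by (intro tendsto_mult_right_zero LIMSEQ_power_zero) auto
    then show "(\<lambda>k. (A ^\<^sub>m k) $$ (i,j)) \<longlonglongrightarrow> 0"
    proof (rule tendsto_0_le[where K = 1])
      show "\<forall>\<^sub>F k in sequentially. cmod ((A ^\<^sub>m k) $$ (i,j)) \<le> norm (b * s ^ k) * 1"
        using order_trans[OF bd abs_ge_self] by simp
    qed
  qed
qed

text \<open>By deflation, convergence of the powers to \<open>V * R\<close> means that the powers of
  \<open>A - V * R\<close> tend to 0. The identity of characteristic polynomials translates the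
  resulting spectral bound back to \<open>A\<close>.\<close>

theorem pow_mat_tendsto_rank_one_iff:
  fixes A :: "complex mat"
  assumes A: "A \<in> carrier_mat n n" and V: "V \<in> carrier_mat n 1" and R: "R \<in> carrier_mat 1 n"
    and AV: "A * V = V" and RA: "R * A = R" and RV: "R * V = 1\<^sub>m 1"
  shows "(\<forall>i<n. \<forall>j<n. (\<lambda>k. (A ^\<^sub>m k) $$ (i,j)) \<longlonglongrightarrow> (V * R) $$ (i,j)) \<longleftrightarrow>
    eigenvalue A 1 \<and> Polynomial.order 1 (char_poly A) = 1 \<and> (\<forall>z. eigenvalue A z \<and> z \<noteq> 1 \<longrightarrow> cmod z < 1)"
proof -
  let ?B = "A - V * R"
  have B: "?B \<in> carrier_mat n n" using A V R by auto
  have chi: "[:0, 1:] * char_poly A = [:-1, 1:] * char_poly ?B"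
    by (rule char_poly_deflate[OF A V R AV RV])
  have nz: "char_poly A \<noteq> 0" "char_poly ?B \<noteq> 0"
    using degree_monic_char_poly[OF A] degree_monic_char_poly[OF B] by auto
  have roots: "z * poly (char_poly A) z = (z - 1) * poly (char_poly ?B) z" for z
    using arg_cong[OF chi, of "\<lambda>q. poly q z"] by (simp add: algebra_simps)
  have ev1: "eigenvalue A 1" using roots[of 1] by (simp add: eigenvalue_root_char_poly[OF A])
  \<comment> \<open>Multiplicities of the root 1 on both sides of \<open>chi\<close>: the factor
    \<open>[:0, 1:]\<close> contributes 0 and \<open>[:-1, 1:]\<close> contributes 1. Hence 1 is a
    simple root for \<open>A\<close> exactly when it is no root for \<open>?B\<close>.\<close>
  have ord: "Polynomial.order 1 (char_poly A) = 1 + Polynomial.order 1 (char_poly ?B)"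
  proof -
    have "Polynomial.order 1 ([:0, 1:] * char_poly A) = Polynomial.order (1::complex) [:0, 1:] + Polynomial.order 1 (char_poly A)"
      using nz by (intro order_mult no_zero_divisors) auto
    moreover have "Polynomial.order (1::complex) [:0, 1:] = 0" by (intro order_0I) simp
    moreover have "Polynomial.order 1 ([:-1, 1:] * char_poly ?B) = Polynomial.order (1::complex) [:-1, 1:] + Polynomial.order 1 (char_poly ?B)"
      using nz by (intro order_mult no_zero_divisors) auto
    moreover have "Polynomial.order (1::complex) [:-1, 1:] = 1"
      using order_power_n_n[of "1::complex" 1] by simp
    ultimately show ?thesis using chi by simp
  qed
  have "(\<forall>i<n. \<forall>j<n. (\<lambda>k. (A ^\<^sub>m k) $$ (i,j)) \<longlonglongrightarrow> (V * R) $$ (i,j)) \<longleftrightarrow>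
    (\<forall>i<n. \<forall>j<n. (\<lambda>k. (?B ^\<^sub>m k) $$ (i,j)) \<longlonglongrightarrow> 0)"
  proof -
    have "(\<lambda>k. (A ^\<^sub>m k) $$ (i,j)) \<longlonglongrightarrow> (V * R) $$ (i,j) \<longleftrightarrow> (\<lambda>k. (?B ^\<^sub>m k) $$ (i,j)) \<longlonglongrightarrow> 0"
      if "i < n" "j < n" for i j
    proof -
      \<comment> \<open>The comparison starts at exponent 1, where the deflation of powers is
        available; the shift does not affect limits.\<close>
      have "(A ^\<^sub>m Suc k) $$ (i,j) - (V * R) $$ (i,j) = (?B ^\<^sub>m Suc k) $$ (i,j)" for k
        unfolding pow_mat_deflate[OF assms] using that V R by (subst index_minus_mat) auto
      then have "(\<lambda>k. (A ^\<^sub>m Suc k) $$ (i,j)) \<longlonglongrightarrow> (V * R) $$ (i,j) \<longleftrightarrow>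
          (\<lambda>k. (?B ^\<^sub>m Suc k) $$ (i,j)) \<longlonglongrightarrow> 0"
        by (subst LIM_zero_iff[symmetric]) (simp only:)
      then show ?thesis
        by (simp only: filterlim_sequentially_Suc[of "\<lambda>k. (A ^\<^sub>m k) $$ (i,j)"]
          filterlim_sequentially_Suc[of "\<lambda>k. (?B ^\<^sub>m k) $$ (i,j)"])
    qed
    then show ?thesis by auto
  qed
  also have "\<dots> \<longleftrightarrow> (\<forall>z. eigenvalue ?B z \<longrightarrow> cmod z < 1)"
    by (rule pow_mat_tendsto_0_iff[OF B])
  also have "\<dots> \<longleftrightarrow> Polynomial.order 1 (char_poly A) = 1 \<and> (\<forall>z. eigenvalue A z \<and> z \<noteq> 1 \<longrightarrow> cmod z < 1)"
    (is "?L \<longleftrightarrow> ?R")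
  proof
    assume L: ?L
    then have "poly (char_poly ?B) 1 \<noteq> 0" by (auto simp: eigenvalue_root_char_poly[OF B])
    then have "Polynomial.order 1 (char_poly ?B) = 0" by (rule order_0I)
    moreover have "cmod z < 1" if "eigenvalue A z" "z \<noteq> 1" for z
      using L roots[of z] that by (auto simp: eigenvalue_root_char_poly[OF B] eigenvalue_root_char_poly[OF A])
    ultimately show ?R using ord by auto
  next
    assume R: ?R
    with ord have "poly (char_poly ?B) 1 \<noteq> 0" using nz by (simp add: order_root)
    show ?L
    proof (intro allI impI)
      fix z assume z: "eigenvalue ?B z"
      then have "z \<noteq> 1" using \<open>poly (char_poly ?B) 1 \<noteq> 0\<close> by (auto simp: eigenvalue_root_char_poly[OF B])
      \<comment> \<open>The only eigenvalue that deflation can introduce is 0, whose modulus is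
        below 1.\<close>
      moreover have "z = 0 \<or> eigenvalue A z"
        using z roots[of z] by (auto simp: eigenvalue_root_char_poly[OF B] eigenvalue_root_char_poly[OF A])
      ultimately show "cmod z < 1" using R by auto
    qed
  qed
  finally show ?thesis using ev1 by blast
qed

text \<open>The gossip matrices are real but their eigenvalues need not be. The complex statement is
  pulled back along the embedding of the reals, which commutes with products and powers and reflects
  limits.\<close>

corollary real_pow_mat_tendsto_rank_one_iff:
  fixes A :: "real mat"
  assumes A: "A \<in> carrier_mat n n" and V: "V \<in> carrier_mat n 1" and R: "R \<in> carrier_mat 1 n"
    and AV: "A * V = V" and RA: "R * A = R" and RV: "R * V = 1\<^sub>m 1"
  shows "(\<forall>i<n. \<forall>j<n. (\<lambda>k. (A ^\<^sub>m k) $$ (i,j)) \<longlonglongrightarrow> (V * R) $$ (i,j)) \<longleftrightarrow>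
    (let C = map_mat complex_of_real A in
      eigenvalue C 1 \<and> Polynomial.order 1 (char_poly C) = 1 \<and> (\<forall>z. eigenvalue C z \<and> z \<noteq> 1 \<longrightarrow> cmod z < 1))"
proof -
  let ?m = "map_mat complex_of_real"
  have "(\<lambda>k. (A ^\<^sub>m k) $$ (i,j)) \<longlonglongrightarrow> (V * R) $$ (i,j) \<longleftrightarrow>
      (\<lambda>k. (?m A ^\<^sub>m k) $$ (i,j)) \<longlonglongrightarrow> (?m V * ?m R) $$ (i,j)" if "i < n" "j < n" for i j
  proof -
    have "(?m A ^\<^sub>m k) $$ (i,j) = complex_of_real ((A ^\<^sub>m k) $$ (i,j))" for k
      unfolding of_real_hom.mat_hom_pow[OF A, symmetric] using that A by simp
    moreover have "(?m V * ?m R) $$ (i,j) = complex_of_real ((V * R) $$ (i,j))"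
      unfolding of_real_hom.mat_hom_mult[OF V R, symmetric] using that V R by simp
    ultimately show ?thesis by (simp only: tendsto_of_real_iff)
  qed
  then have "(\<forall>i<n. \<forall>j<n. (\<lambda>k. (A ^\<^sub>m k) $$ (i,j)) \<longlonglongrightarrow> (V * R) $$ (i,j)) \<longleftrightarrow>
      (\<forall>i<n. \<forall>j<n. (\<lambda>k. (?m A ^\<^sub>m k) $$ (i,j)) \<longlonglongrightarrow> (?m V * ?m R) $$ (i,j))"
    by blast
  moreover have "?m A * ?m V = ?m V" "?m R * ?m A = ?m R" "?m R * ?m V = 1\<^sub>m 1"
    unfolding of_real_hom.mat_hom_mult[OF A V, symmetric] of_real_hom.mat_hom_mult[OF R A, symmetric]
      of_real_hom.mat_hom_mult[OF R V, symmetric] AV RA RV of_real_hom.mat_hom_one by (rule refl)+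
  ultimately show ?thesis
    unfolding Let_def using A V R pow_mat_tendsto_rank_one_iff[of "?m A" n "?m V" "?m R"] by simp
qed

section \<open>Kronecker products and the gossip matrices\<close>

text \<open>Row-major numbering of pairs: \<open>r\<close> stands for its quotient and remainder by
  \<open>N\<close>, with inverse \<open>a * N + b\<close>.\<close>

lemma sum_div_mod:
  fixes f :: "nat \<Rightarrow> nat \<Rightarrow> 'a :: comm_monoid_add"
  shows "(\<Sum>r<N * N. f (r div N) (r mod N)) = (\<Sum>a<N. \<Sum>b<N. f a b)"
proof -
  have lt: "a * N + b < N * N" if "a < N" "b < N" for a b :: nat
  proof -
    have "a * N + b < Suc a * N" using that by simp
    also have "\<dots> \<le> N * N" using that by (intro mult_le_mono1) simp
    finally show ?thesis .
  qed
  have pos: "0 < N" if "r < N * N" for r using that by (cases N) auto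
  have "(\<Sum>r<N * N. f (r div N) (r mod N)) = (\<Sum>(a,b)\<in>{..<N} \<times> {..<N}. f a b)"
    by (rule sum.reindex_bij_witness[where i = "\<lambda>(a,b). a * N + b" and j = "\<lambda>r. (r div N, r mod N)"])
      (auto simp: lt less_mult_imp_div_less pos)
  then show ?thesis by (simp add: sum.cartesian_product)
qed

text \<open>The tensor product of two vectors of length \<open>N\<close>, numbered in the same
  row-major way as \<open>kron\<close>.\<close>

definition kron_vec :: "nat \<Rightarrow> real vec \<Rightarrow> real vec \<Rightarrow> real vec" where
  "kron_vec N a b = vec (N * N) (\<lambda>r. a $ (r div N) * b $ (r mod N))"

lemma kron_vec_carrier [simp]: "kron_vec N a b \<in> carrier_vec (N * N)"
  by (simp add: kron_vec_def)

lemma dim_kron_vec [simp]: "dim_vec (kron_vec N a b) = N * N"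
  by (simp add: kron_vec_def)

lemma kron_vec_index: "r < N * N \<Longrightarrow> kron_vec N a b $ r = a $ (r div N) * b $ (r mod N)"
  by (simp add: kron_vec_def)

lemma sum_kron_vec: "(\<Sum>r<N * N. kron_vec N a b $ r) = (\<Sum>r<N. a $ r) * (\<Sum>r<N. b $ r)"
  by (simp add: kron_vec_index sum_div_mod[of "\<lambda>x y. a $ x * b $ y"] sum_product)

lemma mult_mat_vec_index_sum:
  "A \<in> carrier_mat nr nc \<Longrightarrow> v \<in> carrier_vec nc \<Longrightarrow> i < nr \<Longrightarrow>
    (A *\<^sub>v v) $ i = (\<Sum>j<nc. A $$ (i,j) * v $ j)"
  by (auto simp: scalar_prod_def lessThan_atLeast0)

lemma kron_carrier:
  "A \<in> carrier_mat N N \<Longrightarrow> B \<in> carrier_mat N N \<Longrightarrow> kron A B \<in> carrier_mat (N * N) (N * N)"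
  by (simp add: kron_def)

text \<open>The mixed-product rule: a sum over pair indices of products factors into the product of
  two sums.\<close>

lemma kron_mult_kron_vec:
  assumes A: "A \<in> carrier_mat N N" and B: "B \<in> carrier_mat N N"
    and a: "a \<in> carrier_vec N" and b: "b \<in> carrier_vec N"
  shows "kron A B *\<^sub>v kron_vec N a b = kron_vec N (A *\<^sub>v a) (B *\<^sub>v b)"
proof (intro eq_vecI)
  fix q assume "q < dim_vec (kron_vec N (A *\<^sub>v a) (B *\<^sub>v b))"
  then have q: "q < N * N" by simp
  then have qN: "q div N < N" "q mod N < N" by (cases N; auto simp: less_mult_imp_div_less)+
  have "(kron A B *\<^sub>v kron_vec N a b) $ q = (\<Sum>s<N * N. kron A B $$ (q,s) * kron_vec N a b $ s)"
    by (rule mult_mat_vec_index_sum[OF kron_carrier[OF A B] kron_vec_carrier q])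
  also have "\<dots> = (\<Sum>s<N * N. (\<lambda>x y. (A $$ (q div N, x) * a $ x) * (B $$ (q mod N, y) * b $ y)) (s div N) (s mod N))"
    using q A B by (intro sum.cong) (auto simp: kron_def kron_vec_index)
  also have "\<dots> = (A *\<^sub>v a) $ (q div N) * (B *\<^sub>v b) $ (q mod N)"
    by (subst sum_div_mod)
      (simp add: sum_product mult_mat_vec_index_sum[OF A a qN(1)] mult_mat_vec_index_sum[OF B b qN(2)])
  finally show "(kron A B *\<^sub>v kron_vec N a b) $ q = kron_vec N (A *\<^sub>v a) (B *\<^sub>v b) $ q"
    using q by (simp add: kron_vec_index)
qed (use A B in \<open>simp add: kron_def\<close>)

section \<open>Action of one gossip step on coordinates\<close>

lemma outer_fv_mult_vec:
  assumes "x \<in> carrier_vec n" "j < n"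
  shows "outer u (fv n j) *\<^sub>v x = x $ j \<cdot>\<^sub>v u"
proof (intro eq_vecI)
  fix a assume "a < dim_vec (x $ j \<cdot>\<^sub>v u)"
  then have "a < dim_vec u" by simp
  then have "(outer u (fv n j) *\<^sub>v x) $ a = (\<Sum>b\<in>{0..<n}. u $ a * (if b = j then 1 else 0) * x $ b)"
    using assms by (simp add: outer_def fv_def scalar_prod_def)
  also have "\<dots> = (\<Sum>b\<in>{0..<n}. if b = j then u $ a * x $ b else 0)"
    by (intro sum.cong) auto
  finally show "(outer u (fv n j) *\<^sub>v x) $ a = (x $ j \<cdot>\<^sub>v u) $ a"
    using assms \<open>a < dim_vec u\<close> by simp
qed (simp add: outer_def)

lemma smult_mat_mult_vec:
  fixes A :: "'a :: comm_semiring_0 mat"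
  shows "A \<in> carrier_mat nr nc \<Longrightarrow> v \<in> carrier_vec nc \<Longrightarrow> (k \<cdot>\<^sub>m A) *\<^sub>v v = k \<cdot>\<^sub>v (A *\<^sub>v v)"
  by (intro eq_vecI) auto

lemma outer_carrier: "outer u v \<in> carrier_mat (dim_vec u) (dim_vec v)"
  by (simp add: outer_def)

lemma Dm_carrier [simp]: "Dm n w j i \<in> carrier_mat n n"
  by (simp add: Dm_def outer_def fv_def)

lemma Lm_carrier [simp]: "Lm n w j i \<in> carrier_mat n n"
  by (auto simp: Lm_def outer_def fv_def)

lemma Sm_carrier [simp]: "Sm n j i \<in> carrier_mat n n"
  by (auto simp: Sm_def outer_def fv_def)

lemma Mm_carrier [simp]: "Mm n w \<epsilon> j i \<in> carrier_mat (2 * n) (2 * n)"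
proof -
  have "Mm n w \<epsilon> j i \<in> carrier_mat (n + n) (n + n)"
    unfolding Mm_def
    by (intro four_block_carrier_mat minus_carrier_mat smult_carrier_mat Dm_carrier Lm_carrier)
  then show ?thesis by (simp add: mult_2)
qed

lemma Dm_mult_vec:
  assumes "x \<in> carrier_vec n" "i < n"
  shows "Dm n w j i *\<^sub>v x = (w i j * x $ i) \<cdot>\<^sub>v unit_vec n i"
  unfolding Dm_def using assms outer_carrier[of "fv n i" "fv n i"]
  by (subst smult_mat_mult_vec[of _ n n])
    (auto simp: outer_fv_mult_vec smult_smult_assoc, auto simp: fv_def)

lemma Lm_mult_vec:
  assumes x: "x \<in> carrier_vec n" and "i < n" "j < n"
  shows "Lm n w j i *\<^sub>v x = (w i j * (x $ i - x $ j)) \<cdot>\<^sub>v unit_vec n i"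
proof -
  have o: "outer (fv n i) (fv n j) \<in> carrier_mat n n"
    using outer_carrier[of "fv n i" "fv n j"] by (simp add: fv_def)
  have "Lm n w j i *\<^sub>v x = Dm n w j i *\<^sub>v x - (w i j \<cdot>\<^sub>m outer (fv n i) (fv n j)) *\<^sub>v x"
    unfolding Lm_def using o x by (intro minus_mult_distrib_mat_vec) auto
  also have "\<dots> = (w i j * x $ i) \<cdot>\<^sub>v unit_vec n i - w i j \<cdot>\<^sub>v (x $ j \<cdot>\<^sub>v unit_vec n i)"
    using assms by (simp add: Dm_mult_vec smult_mat_mult_vec[OF o] outer_fv_mult_vec, simp add: fv_def)
  also have "\<dots> = (w i j * (x $ i - x $ j)) \<cdot>\<^sub>v unit_vec n i"
    by (intro eq_vecI) (auto simp: algebra_simps)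
  finally show ?thesis .
qed

lemma Sm_mult_vec:
  assumes x: "x \<in> carrier_vec n" and "j < n"
  shows "Sm n j i *\<^sub>v x = x - x $ j \<cdot>\<^sub>v (unit_vec n j - unit_vec n i)"
proof -
  have o: "outer (fv n j - fv n i) (fv n j) \<in> carrier_mat n n"
    using outer_carrier[of "fv n j - fv n i" "fv n j"] by (simp add: fv_def)
  have "Sm n j i *\<^sub>v x = 1\<^sub>m n *\<^sub>v x - outer (fv n j - fv n i) (fv n j) *\<^sub>v x"
    unfolding Sm_def using o x by (intro minus_mult_distrib_mat_vec) auto
  then show ?thesis
    using assms by (simp add: outer_fv_mult_vec, simp add: fv_def)
qed

text \<open>The state is split into its halves \<open>x\<close> and \<open>s\<close>, to which the
  blocks apply separately. In the result, whatever \<open>x\<close> gains at \<open>i\<close> is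
  taken from \<open>s\<close> at \<open>i\<close>, and \<open>j\<close> hands its whole surplus to
  \<open>i\<close>.\<close>

lemma Mm_mult_vec:
  assumes z: "z \<in> carrier_vec (2 * n)" and ij: "i < n" "j < n" and a: "a < n"
  shows "(Mm n w \<epsilon> j i *\<^sub>v z) $ a =
      z $ a + (if a = i then \<epsilon> * w i j * z $ (n + i) - w i j * (z $ i - z $ j) else 0)" (is ?upper)
    and "(Mm n w \<epsilon> j i *\<^sub>v z) $ (n + a) =
      z $ (n + a) + (if a = i then w i j * (z $ i - z $ j) - \<epsilon> * w i j * z $ (n + i) + z $ (n + j) else 0)
        - (if a = j then z $ (n + j) else 0)" (is ?lower)
proof -
  define x s where "x = vec n (\<lambda>a. z $ a)" and "s = vec n (\<lambda>a. z $ (n + a))"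
  have xs: "x \<in> carrier_vec n" "s \<in> carrier_vec n" by (auto simp: x_def s_def)
  have zxs: "z = x @\<^sub>v s"
    using z by (intro eq_vecI) (auto simp: x_def s_def)
  have "Mm n w \<epsilon> j i *\<^sub>v z =
      ((1\<^sub>m n - Lm n w j i) *\<^sub>v x + (\<epsilon> \<cdot>\<^sub>m Dm n w j i) *\<^sub>v s) @\<^sub>v
      (Lm n w j i *\<^sub>v x + (Sm n j i - \<epsilon> \<cdot>\<^sub>m Dm n w j i) *\<^sub>v s)"
    unfolding zxs Mm_def
    by (rule four_block_mat_mult_vec[OF minus_carrier_mat[OF Lm_carrier] smult_carrier_mat[OF Dm_carrier]
        Lm_carrier minus_carrier_mat[OF smult_carrier_mat[OF Dm_carrier]] xs])
  also have "(1\<^sub>m n - Lm n w j i) *\<^sub>v x = x - Lm n w j i *\<^sub>v x"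
    using xs by (subst minus_mult_distrib_mat_vec[of _ n n]) auto
  also have "(Sm n j i - \<epsilon> \<cdot>\<^sub>m Dm n w j i) *\<^sub>v s = Sm n j i *\<^sub>v s - (\<epsilon> \<cdot>\<^sub>m Dm n w j i) *\<^sub>v s"
    using xs by (subst minus_mult_distrib_mat_vec[of _ n n]) auto
  also have "(\<epsilon> \<cdot>\<^sub>m Dm n w j i) *\<^sub>v s = \<epsilon> \<cdot>\<^sub>v (Dm n w j i *\<^sub>v s)"
    using xs by (intro smult_mat_mult_vec[of _ n n]) auto
  finally have *: "Mm n w \<epsilon> j i *\<^sub>v z =
      (x - Lm n w j i *\<^sub>v x + \<epsilon> \<cdot>\<^sub>v (Dm n w j i *\<^sub>v s)) @\<^sub>v
      (Lm n w j i *\<^sub>v x + (Sm n j i *\<^sub>v s - \<epsilon> \<cdot>\<^sub>v (Dm n w j i *\<^sub>v s)))" .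
  show ?upper ?lower
    unfolding * Lm_mult_vec[OF xs(1) ij] Dm_mult_vec[OF xs(2) ij(1)] Sm_mult_vec[OF xs(2) ij(2)]
    using a ij xs by (auto simp: x_def s_def)
qed

lemma sum_lessThan_double:
  fixes f :: "nat \<Rightarrow> 'a :: comm_monoid_add"
  shows "(\<Sum>a<2 * n. f a) = (\<Sum>a<n. f a) + (\<Sum>a<n. f (n + a))"
proof -
  have "{..<2 * n} = {..<n} \<union> (+) n ` {..<n}"
  proof (intro Set.set_eqI iffI)
    fix a assume "a \<in> {..<2 * n}"
    then show "a \<in> {..<n} \<union> (+) n ` {..<n}"
      by (cases "a < n") (auto intro!: image_eqI[of _ _ "a - n"])
  qed auto
  then have "(\<Sum>a<2 * n. f a) = (\<Sum>a<n. f a) + sum f ((+) n ` {..<n})"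
    by (simp only:, intro sum.union_disjoint) auto
  then show ?thesis by (simp add: sum.reindex)
qed

text \<open>A step only moves mass between coordinates. This makes the all-ones row a left
  eigenvector of the Kronecker average.\<close>

lemma sum_Mm_mult_vec:
  assumes "z \<in> carrier_vec (2 * n)" "i < n" "j < n"
  shows "(\<Sum>a<2 * n. (Mm n w \<epsilon> j i *\<^sub>v z) $ a) = (\<Sum>a<2 * n. z $ a)"
  using assms by (simp add: sum_lessThan_double Mm_mult_vec sum.distrib sum_subtractf)

text \<open>The state of perfect agreement on the value 1 with zero surplus.\<close>

definition consensus_vec :: "nat \<Rightarrow> real vec" where
  "consensus_vec n = vec (2 * n) (\<lambda>a. if a < n then 1 else 0)"

lemma consensus_vec_carrier [simp]: "consensus_vec n \<in> carrier_vec (2 * n)"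
  by (simp add: consensus_vec_def)

lemma consensus_vec_index: "a < 2 * n \<Longrightarrow> consensus_vec n $ a = (if a < n then 1 else 0)"
  by (simp add: consensus_vec_def)

lemma sum_consensus_vec: "(\<Sum>a<2 * n. consensus_vec n $ a) = real n"
  by (simp add: sum_lessThan_double consensus_vec_index)

lemma less_doubleE:
  fixes a n :: nat
  assumes "a < 2 * n"
  obtains "a < n" | b where "a = n + b" "b < n"
  using assms by (metis add_diff_inverse_nat mult_2 nat_add_left_cancel_less)

text \<open>Every update is driven by a difference of \<open>x\<close> values or by a surplus, and
  all of these vanish here.\<close>

lemma Mm_mult_consensus_vec:
  assumes "i < n" "j < n"
  shows "Mm n w \<epsilon> j i *\<^sub>v consensus_vec n = consensus_vec n"
proof (intro eq_vecI)
  fix a assume "a < dim_vec (consensus_vec n)"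
  then have "a < 2 * n" by (simp add: consensus_vec_def)
  then show "(Mm n w \<epsilon> j i *\<^sub>v consensus_vec n) $ a = consensus_vec n $ a"
    using assms by (elim less_doubleE) (simp_all add: Mm_mult_vec consensus_vec_index)
qed (simp add: consensus_vec_def carrier_matD(1)[OF Mm_carrier])

section \<open>Second moments\<close>

text \<open>Standard basis vectors of the large space are pure tensors, so entries of matrix powers
  can be read as moments of runs from unit vectors.\<close>

lemma kron_vec_unit_vec:
  assumes "s < N * N"
  shows "kron_vec N (unit_vec N (s div N)) (unit_vec N (s mod N)) = unit_vec (N * N) s"
proof (intro eq_vecI)
  fix q assume "q < dim_vec (unit_vec (N * N) s :: real vec)"
  then have q: "q < N * N" by simp
  have "0 < N" using assms by (cases N) auto
  then have "q div N < N" "q mod N < N" "s div N < N" "s mod N < N"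
    using assms q by (auto simp: less_mult_imp_div_less)
  moreover have "q = s \<longleftrightarrow> q div N = s div N \<and> q mod N = s mod N"
    by (metis mod_div_mult_eq)
  ultimately show "kron_vec N (unit_vec N (s div N)) (unit_vec N (s mod N)) $ q = unit_vec (N * N) s $ q"
    using q assms by (auto simp: kron_vec_index)
qed simp

text \<open>Each summand lies between 0 and the whole sum. This reduces convergence of expected
  squared norms to single coordinates.\<close>

lemma tendsto_sum_nonneg_0_iff:
  fixes f :: "'i \<Rightarrow> nat \<Rightarrow> real"
  assumes I: "finite I" and nonneg: "\<And>i k. i \<in> I \<Longrightarrow> 0 \<le> f i k"
  shows "(\<lambda>k. \<Sum>i\<in>I. f i k) \<longlonglongrightarrow> 0 \<longleftrightarrow> (\<forall>i\<in>I. f i \<longlonglongrightarrow> 0)"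
proof
  assume L: "(\<lambda>k. \<Sum>i\<in>I. f i k) \<longlonglongrightarrow> 0"
  show "\<forall>i\<in>I. f i \<longlonglongrightarrow> 0"
  proof
    fix i assume i: "i \<in> I"
    have "f i k \<le> (\<Sum>i\<in>I. f i k)" for k
      using i I nonneg by (intro member_le_sum[of i I "\<lambda>i. f i k"]) auto
    moreover have "0 \<le> f i k" for k using nonneg i by simp
    ultimately show "f i \<longlonglongrightarrow> 0"
      by (intro tendsto_sandwich[OF _ _ tendsto_const L]) auto
  qed
next
  assume "\<forall>i\<in>I. f i \<longlonglongrightarrow> 0"
  then show "(\<lambda>k. \<Sum>i\<in>I. f i k) \<longlonglongrightarrow> 0"
    by (intro tendsto_null_sum) auto
qed

section \<open>Mixed moments of runs and powers of the Kronecker average\<close>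

locale gossip =
  fixes n :: nat and E :: "(nat \<times> nat) set" and p w :: "nat \<Rightarrow> nat \<Rightarrow> real" and \<epsilon> :: real
  assumes n_gt_1: "n > 1"
    and edges: "E \<subseteq> {0..<n} \<times> {0..<n}"
    and no_loops: "\<forall>(j,i)\<in>E. j \<noteq> i"
    and prob: "\<forall>(j,i)\<in>E. 0 < p i j \<and> p i j < 1"
    and prob_sum: "(\<Sum>(j,i)\<in>E. p i j) = 1"
    and weight: "\<forall>(j,i)\<in>E. 0 < w i j \<and> w i j < 1"
begin

abbreviation M :: "nat \<Rightarrow> nat \<Rightarrow> real mat" where
  "M \<equiv> Mm n w \<epsilon>"

abbreviation A :: "real mat" where
  "A \<equiv> EMM n E p w \<epsilon>"

lemma finite_E: "finite E"
  using edges by (rule finite_subset) auto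

lemma edge_less: "(j,i) \<in> E \<Longrightarrow> i < n" "(j,i) \<in> E \<Longrightarrow> j < n"
  using edges by auto

lemma M_mult_carrier [simp]: "M j i *\<^sub>v z \<in> carrier_vec (2 * n)"
  using Mm_carrier[of n w \<epsilon> j i] by (intro carrier_vecI) (simp add: carrier_matD(1)[OF Mm_carrier])

lemma A_carrier: "A \<in> carrier_mat (2 * n * (2 * n)) (2 * n * (2 * n))"
  by (intro carrier_matI) (simp_all add: EMM_def)

lemma A_mult_kron_vec:
  assumes a: "a \<in> carrier_vec (2 * n)" and b: "b \<in> carrier_vec (2 * n)" and q: "q < 2 * n * (2 * n)"
  shows "(A *\<^sub>v kron_vec (2 * n) a b) $ q = (\<Sum>(j,i)\<in>E. p i j * kron_vec (2 * n) (M j i *\<^sub>v a) (M j i *\<^sub>v b) $ q)"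
proof -
  let ?N = "2 * n" and ?K = "\<lambda>j i. kron (M j i) (M j i)"
  have "(A *\<^sub>v kron_vec ?N a b) $ q = (\<Sum>s<?N * ?N. A $$ (q,s) * kron_vec ?N a b $ s)"
    by (rule mult_mat_vec_index_sum[OF A_carrier kron_vec_carrier q])
  also have "\<dots> = (\<Sum>s<?N * ?N. \<Sum>e\<in>E. p (snd e) (fst e) * (?K (fst e) (snd e) $$ (q,s) * kron_vec ?N a b $ s))"
    using q by (intro sum.cong) (auto simp: EMM_def sum_distrib_right case_prod_unfold mult.assoc)
  also have "\<dots> = (\<Sum>e\<in>E. \<Sum>s<?N * ?N. p (snd e) (fst e) * (?K (fst e) (snd e) $$ (q,s) * kron_vec ?N a b $ s))"
    by (rule sum.swap)
  also have "\<dots> = (\<Sum>e\<in>E. p (snd e) (fst e) * (?K (fst e) (snd e) *\<^sub>v kron_vec ?N a b) $ q)"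
    by (simp only: mult_mat_vec_index_sum[OF kron_carrier[OF Mm_carrier Mm_carrier] kron_vec_carrier q] sum_distrib_left)
  also have "\<dots> = (\<Sum>(j,i)\<in>E. p i j * kron_vec ?N (M j i *\<^sub>v a) (M j i *\<^sub>v b) $ q)"
    by (simp only: kron_mult_kron_vec[OF Mm_carrier Mm_carrier a b] case_prod_unfold)
  finally show ?thesis .
qed

text \<open>The expectation of coordinate \<open>r\<close> of the run from \<open>a\<close> times
  coordinate \<open>c\<close> of the run from \<open>b\<close> after \<open>k\<close> steps, both
  runs driven by the same random edges.\<close>

definition moment :: "nat \<Rightarrow> real vec \<Rightarrow> real vec \<Rightarrow> nat \<Rightarrow> nat \<Rightarrow> real" where
  "moment k a b r c = (\<Sum>es\<in>seqs E k. seq_prob p es * (run n w \<epsilon> es a $ r * run n w \<epsilon> es b $ c))"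

lemma seqs_Suc: "seqs E (Suc k) = (\<lambda>(e,es). e # es) ` (E \<times> seqs E k)"
  by (auto simp: seqs_def length_Suc_conv image_iff)

lemma moment_0 [simp]: "moment 0 a b r c = a $ r * b $ c"
proof -
  have "seqs E 0 = {[]}" by (auto simp: seqs_def)
  then show ?thesis by (simp add: moment_def seq_prob_def)
qed

text \<open>Conditioning on the first edge: it advances both initial vectors, and the remaining
  \<open>k\<close> edges are again independent draws.\<close>

lemma moment_Suc: "moment (Suc k) a b r c = (\<Sum>(j,i)\<in>E. p i j * moment k (M j i *\<^sub>v a) (M j i *\<^sub>v b) r c)"
proof -
  have "inj_on (\<lambda>(e,es). e # es) (E \<times> seqs E k)" by (auto simp: inj_on_def)
  then have "moment (Suc k) a b r c = (\<Sum>(e,es)\<in>E \<times> seqs E k.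
      seq_prob p (e # es) * (run n w \<epsilon> (e # es) a $ r * run n w \<epsilon> (e # es) b $ c))"
    unfolding moment_def seqs_Suc by (simp add: sum.reindex case_prod_unfold)
  also have "\<dots> = (\<Sum>e\<in>E. \<Sum>es\<in>seqs E k.
      seq_prob p (e # es) * (run n w \<epsilon> (e # es) a $ r * run n w \<epsilon> (e # es) b $ c))"
    by (rule sum.cartesian_product[symmetric])
  also have "\<dots> = (\<Sum>(j,i)\<in>E. p i j * moment k (M j i *\<^sub>v a) (M j i *\<^sub>v b) r c)"
    by (intro sum.cong) (auto simp: moment_def seq_prob_def sum_distrib_left mult.assoc)
  finally show ?thesis .
qed

text \<open>One factor \<open>A\<close> averages the pure tensor over one step of both runs, which
  is the recursion of \<open>moment\<close>. As the first edge changes the initial vectors, the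
  induction is over all \<open>a\<close> and \<open>b\<close>.\<close>

lemma pow_A_mult_kron_vec:
  assumes "a \<in> carrier_vec (2 * n)" "b \<in> carrier_vec (2 * n)" and q: "q < 2 * n * (2 * n)"
  shows "(A ^\<^sub>m k *\<^sub>v kron_vec (2 * n) a b) $ q = moment k a b (q div (2 * n)) (q mod (2 * n))"
  using assms(1,2)
proof (induction k arbitrary: a b)
  case 0
  have "A ^\<^sub>m 0 *\<^sub>v kron_vec (2 * n) a b = kron_vec (2 * n) a b"
    by (simp only: pow_mat.simps carrier_matD(1)[OF A_carrier] one_mult_mat_vec[OF kron_vec_carrier])
  then show ?case by (simp only: kron_vec_index[OF q] moment_0)
next
  case (Suc k)
  let ?N = "2 * n"
  have Ak: "A ^\<^sub>m k \<in> carrier_mat (?N * ?N) (?N * ?N)" by (rule pow_carrier_mat[OF A_carrier])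
  have Au: "A *\<^sub>v kron_vec ?N a b \<in> carrier_vec (?N * ?N)" by (rule mult_mat_vec_carrier[OF A_carrier kron_vec_carrier])
  have "(A ^\<^sub>m Suc k *\<^sub>v kron_vec ?N a b) $ q = (A ^\<^sub>m k *\<^sub>v (A *\<^sub>v kron_vec ?N a b)) $ q"
    by (simp only: pow_mat.simps assoc_mult_mat_vec[OF Ak A_carrier kron_vec_carrier])
  also have "\<dots> = (\<Sum>s<?N * ?N. (A ^\<^sub>m k) $$ (q,s) * (A *\<^sub>v kron_vec ?N a b) $ s)"
    by (rule mult_mat_vec_index_sum[OF Ak Au q])
  also have "\<dots> = (\<Sum>s<?N * ?N. \<Sum>e\<in>E. p (snd e) (fst e) *
      ((A ^\<^sub>m k) $$ (q,s) * kron_vec ?N (M (fst e) (snd e) *\<^sub>v a) (M (fst e) (snd e) *\<^sub>v b) $ s))"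
    by (intro sum.cong refl)
      (simp add: A_mult_kron_vec[OF Suc.prems] sum_distrib_left case_prod_unfold mult.left_commute)
  also have "\<dots> = (\<Sum>e\<in>E. \<Sum>s<?N * ?N. p (snd e) (fst e) *
      ((A ^\<^sub>m k) $$ (q,s) * kron_vec ?N (M (fst e) (snd e) *\<^sub>v a) (M (fst e) (snd e) *\<^sub>v b) $ s))"
    by (rule sum.swap)
  also have "\<dots> = (\<Sum>e\<in>E. p (snd e) (fst e) *
      (A ^\<^sub>m k *\<^sub>v kron_vec ?N (M (fst e) (snd e) *\<^sub>v a) (M (fst e) (snd e) *\<^sub>v b)) $ q)"
    by (simp only: mult_mat_vec_index_sum[OF Ak kron_vec_carrier q] sum_distrib_left)
  also have "\<dots> = moment (Suc k) a b (q div ?N) (q mod ?N)"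
    unfolding moment_Suc case_prod_unfold using Suc.IH[OF M_mult_carrier M_mult_carrier] by simp
  finally show ?case .
qed

section \<open>Bilinearity of moments and the Cauchy-Schwarz bound\<close>

lemma run_carrier: "z \<in> carrier_vec (2 * n) \<Longrightarrow> run n w \<epsilon> es z \<in> carrier_vec (2 * n)"
  by (induction n w \<epsilon> es z rule: run.induct) (auto intro: mult_mat_vec_carrier[OF Mm_carrier])

lemma run_add:
  "a \<in> carrier_vec (2 * n) \<Longrightarrow> b \<in> carrier_vec (2 * n) \<Longrightarrow>
    run n w \<epsilon> es (a + b) = run n w \<epsilon> es a + run n w \<epsilon> es b"
proof (induction es arbitrary: a b)
  case (Cons e es)
  then show ?case by (cases e) (simp add: mult_add_distrib_mat_vec[OF Mm_carrier])
qed simp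

lemma run_smult:
  "a \<in> carrier_vec (2 * n) \<Longrightarrow> run n w \<epsilon> es (t \<cdot>\<^sub>v a) = t \<cdot>\<^sub>v run n w \<epsilon> es a"
proof (induction es arbitrary: a)
  case (Cons e es)
  then show ?case by (cases e) (simp add: mult_mat_vec[OF Mm_carrier])
qed simp

lemma run_consensus_vec: "set es \<subseteq> E \<Longrightarrow> run n w \<epsilon> es (consensus_vec n) = consensus_vec n"
proof (induction es)
  case (Cons e es)
  then show ?case by (cases e) (auto simp: Mm_mult_consensus_vec edge_less)
qed simp

lemma moment_commute: "moment k a b r c = moment k b a c r"
  by (simp add: moment_def mult.commute)

lemma moment_add_left:
  assumes "a \<in> carrier_vec (2 * n)" "b \<in> carrier_vec (2 * n)" "r < 2 * n"
  shows "moment k (a + b) z r c = moment k a z r c + moment k b z r c"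
  using assms carrier_vecD[OF run_carrier[OF assms(2)]]
  by (simp add: moment_def run_add distrib_left distrib_right sum.distrib)

lemma moment_smult_left:
  assumes "a \<in> carrier_vec (2 * n)" "r < 2 * n"
  shows "moment k (t \<cdot>\<^sub>v a) z r c = t * moment k a z r c"
  using assms carrier_vecD[OF run_carrier[OF assms(1)]]
  by (simp add: moment_def run_smult sum_distrib_left mult_ac)

lemma moment_add_right:
  assumes "a \<in> carrier_vec (2 * n)" "b \<in> carrier_vec (2 * n)" "c < 2 * n"
  shows "moment k z (a + b) r c = moment k z a r c + moment k z b r c"
  using moment_add_left[OF assms] by (simp add: moment_commute[of k z])

lemma moment_smult_right:
  assumes "a \<in> carrier_vec (2 * n)" "c < 2 * n"
  shows "moment k z (t \<cdot>\<^sub>v a) r c = t * moment k z a r c"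
  using moment_smult_left[OF assms] by (simp add: moment_commute[of k z])

lemma seq_prob_nonneg: "es \<in> seqs E k \<Longrightarrow> 0 \<le> seq_prob p es"
  unfolding seq_prob_def using prob by (intro prod_list_nonneg) (force simp: seqs_def)

lemma moment_nonneg: "0 \<le> moment k z z r r"
  unfolding moment_def by (intro sum_nonneg mult_nonneg_nonneg[OF seq_prob_nonneg]) auto

lemma moment_consensus_vec: "moment k (consensus_vec n) (consensus_vec n) r c = consensus_vec n $ r * consensus_vec n $ c"
proof (induction k)
  case (Suc k)
  have "moment (Suc k) (consensus_vec n) (consensus_vec n) r c = (\<Sum>(j,i)\<in>E. p i j * (consensus_vec n $ r * consensus_vec n $ c))"
    unfolding moment_Suc using Suc by (intro sum.cong) (auto simp: Mm_mult_consensus_vec edge_less)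
  then show ?case
    using prob_sum by (simp add: case_prod_unfold sum_distrib_right[symmetric])
qed simp

text \<open>Giving each factor the square root of the probability weight turns this into the
  ordinary inequality for finite sums over edge sequences.\<close>

lemma moment_Cauchy_Schwarz: "\<bar>moment k a b r c\<bar> \<le> sqrt (moment k a a r r) * sqrt (moment k b b c c)"
proof -
  let ?f = "\<lambda>es. sqrt (seq_prob p es) * run n w \<epsilon> es a $ r"
  let ?g = "\<lambda>es. sqrt (seq_prob p es) * run n w \<epsilon> es b $ c"
  have "moment k a b r c = (\<Sum>es\<in>seqs E k. ?f es * ?g es)" (is "_ = ?S")
    unfolding moment_def
  proof (intro sum.cong refl)
    fix es assume "es \<in> seqs E k"
    then have "sqrt (seq_prob p es) * sqrt (seq_prob p es) = seq_prob p es"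
      by (simp add: seq_prob_nonneg)
    then show "seq_prob p es * (run n w \<epsilon> es a $ r * run n w \<epsilon> es b $ c) = ?f es * ?g es"
      by (metis mult.assoc mult.left_commute)
  qed
  then have "\<bar>moment k a b r c\<bar> = \<bar>?S\<bar>" by (simp only:)
  also have "\<bar>?S\<bar> \<le> (\<Sum>es\<in>seqs E k. \<bar>?f es\<bar> * \<bar>?g es\<bar>)"
    unfolding abs_mult[symmetric] by (rule sum_abs)
  also have "\<dots> \<le> L2_set ?f (seqs E k) * L2_set ?g (seqs E k)"
    by (rule L2_set_mult_ineq)
  also have "L2_set ?f (seqs E k) = sqrt (moment k a a r r)"
    unfolding moment_def L2_set_def
    by (intro arg_cong[of _ _ sqrt] sum.cong refl)
      (simp add: seq_prob_nonneg power_mult_distrib power2_eq_square[of "_ $ _"])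
  also have "L2_set ?g (seqs E k) = sqrt (moment k b b c c)"
    unfolding moment_def L2_set_def
    by (intro arg_cong[of _ _ sqrt] sum.cong refl)
      (simp add: seq_prob_nonneg power_mult_distrib power2_eq_square[of "_ $ _"])
  finally show ?thesis .
qed

text \<open>One vanishing second moment suffices when the other one converges. The limit
  \<open>\<beta>\<close> is left arbitrary so that a decaying vector can be paired with
  \<open>consensus_vec\<close>.\<close>

lemma moment_tendsto_0:
  assumes "(\<lambda>k. moment k a a r r) \<longlonglongrightarrow> 0" and "(\<lambda>k. moment k b b c c) \<longlonglongrightarrow> \<beta>"
  shows "(\<lambda>k. moment k a b r c) \<longlonglongrightarrow> 0"
proof -
  have "(\<lambda>k. sqrt (moment k a a r r) * sqrt (moment k b b c c)) \<longlonglongrightarrow> sqrt 0 * sqrt \<beta>"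
    by (intro tendsto_intros assms)
  then have "(\<lambda>k. sqrt (moment k a a r r) * sqrt (moment k b b c c)) \<longlonglongrightarrow> 0" by simp
  then show ?thesis
  proof (rule tendsto_0_le[where K = 1])
    show "\<forall>\<^sub>F k in sequentially. norm (moment k a b r c) \<le> norm (sqrt (moment k a a r r) * sqrt (moment k b b c c)) * 1"
      using moment_Cauchy_Schwarz[of _ a b r c] by (simp add: moment_nonneg)
  qed
qed

section \<open>Initial vectors whose second moments vanish\<close>

definition decays :: "real vec \<Rightarrow> bool" where
  "decays z \<longleftrightarrow> (\<forall>r<2 * n. (\<lambda>k. moment k z z r r) \<longlonglongrightarrow> 0)"

text \<open>The cross moments in the expansion vanish by Cauchy-Schwarz.\<close>

lemma decays_add:
  assumes c: "a \<in> carrier_vec (2 * n)" "b \<in> carrier_vec (2 * n)" and d: "decays a" "decays b"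
  shows "decays (a + b)"
  unfolding decays_def
proof (intro allI impI)
  fix r assume r: "r < 2 * n"
  have ab: "(\<lambda>k. moment k a a r r) \<longlonglongrightarrow> 0" "(\<lambda>k. moment k b b r r) \<longlonglongrightarrow> 0"
    using d r by (auto simp: decays_def)
  have "(\<lambda>k. moment k a a r r + moment k a b r r + (moment k b a r r + moment k b b r r)) \<longlonglongrightarrow> 0 + 0 + (0 + 0)"
    by (intro tendsto_add moment_tendsto_0[OF ab(1) ab(2)] moment_tendsto_0[OF ab(2) ab(1)] ab)
  then show "(\<lambda>k. moment k (a + b) (a + b) r r) \<longlonglongrightarrow> 0"
    using c r by (simp add: moment_add_left moment_add_right add_ac)
qed

lemma decays_smult:
  assumes "a \<in> carrier_vec (2 * n)" "decays a"
  shows "decays (t \<cdot>\<^sub>v a)"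
  unfolding decays_def
proof (intro allI impI)
  fix r assume r: "r < 2 * n"
  have "(\<lambda>k. t * (t * moment k a a r r)) \<longlonglongrightarrow> t * (t * 0)"
    using assms r by (intro tendsto_mult_left) (simp add: decays_def)
  then show "(\<lambda>k. moment k (t \<cdot>\<^sub>v a) (t \<cdot>\<^sub>v a) r r) \<longlonglongrightarrow> 0"
    using assms r by (simp add: moment_smult_left moment_smult_right)
qed

text \<open>The moment at time \<open>Suc k\<close> is a sum of nonnegative terms, one of which is
  \<open>p i j\<close> times the moment from \<open>M j i *\<^sub>v z\<close>. Positivity of
  \<open>p i j\<close> allows division.\<close>

lemma decays_M_mult:
  assumes "decays z" and e: "(j,i) \<in> E"
  shows "decays (M j i *\<^sub>v z)"
  unfolding decays_def
proof (intro allI impI)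
  fix r assume "r < 2 * n"
  then have "(\<lambda>k. moment (Suc k) z z r r) \<longlonglongrightarrow> 0"
    using assms by (intro filterlim_sequentially_Suc[of "\<lambda>k. moment k z z r r", THEN iffD2]) (simp add: decays_def)
  then show "(\<lambda>k. moment k (M j i *\<^sub>v z) (M j i *\<^sub>v z) r r) \<longlonglongrightarrow> 0"
  proof (rule tendsto_0_le[where K = "1 / p i j"])
    have p: "0 < p i j" using prob e by auto
    have "p i j * moment k (M j i *\<^sub>v z) (M j i *\<^sub>v z) r r \<le> moment (Suc k) z z r r" for k
    proof -
      let ?h = "\<lambda>(j,i). p i j * moment k (M j i *\<^sub>v z) (M j i *\<^sub>v z) r r"
      have "?h (j,i) \<le> sum ?h E"
        using prob by (intro member_le_sum[OF e _ finite_E]) (force intro!: mult_nonneg_nonneg moment_nonneg)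
      then show ?thesis by (simp add: moment_Suc)
    qed
    then show "\<forall>\<^sub>F k in sequentially. norm (moment k (M j i *\<^sub>v z) (M j i *\<^sub>v z) r r)
        \<le> norm (moment (Suc k) z z r r) * (1 / p i j)"
      using p by (simp add: moment_nonneg pos_le_divide_eq mult.commute)
  qed
qed

section \<open>Entries of the powers and their rank-one limit\<close>

lemma pow_A_index:
  assumes q: "q < 2 * n * (2 * n)" and s: "s < 2 * n * (2 * n)"
  shows "(A ^\<^sub>m k) $$ (q,s) = moment k (unit_vec (2 * n) (s div (2 * n))) (unit_vec (2 * n) (s mod (2 * n)))
    (q div (2 * n)) (q mod (2 * n))"
proof -
  let ?N = "2 * n"
  have Ak: "A ^\<^sub>m k \<in> carrier_mat (?N * ?N) (?N * ?N)" by (rule pow_carrier_mat[OF A_carrier])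
  have "(A ^\<^sub>m k *\<^sub>v unit_vec (?N * ?N) s) $ q = (\<Sum>t<?N * ?N. (A ^\<^sub>m k) $$ (q,t) * unit_vec (?N * ?N) s $ t)"
    by (rule mult_mat_vec_index_sum[OF Ak unit_vec_carrier q])
  also have "\<dots> = (\<Sum>t<?N * ?N. if t = s then (A ^\<^sub>m k) $$ (q,t) else 0)"
    using s by (intro sum.cong) auto
  also have "\<dots> = (A ^\<^sub>m k) $$ (q,s)" using s by (subst sum.delta) auto
  finally show ?thesis
    unfolding kron_vec_unit_vec[OF s, symmetric] pow_A_mult_kron_vec[OF unit_vec_carrier unit_vec_carrier q] by simp
qed

definition limV :: "real mat" where
  "limV = mat (2 * n * (2 * n)) 1 (\<lambda>(q,_). kron_vec (2 * n) (consensus_vec n) (consensus_vec n) $ q)"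

text \<open>The all-ones row, scaled so that its product with \<open>limV\<close> is 1: the
  coordinates of \<open>limV\<close> sum to the square of \<open>n\<close>.\<close>

definition limR :: "real mat" where
  "limR = mat 1 (2 * n * (2 * n)) (\<lambda>_. 1 / (real n)\<^sup>2)"

lemma limV_carrier: "limV \<in> carrier_mat (2 * n * (2 * n)) 1"
  unfolding limV_def by (rule mat_carrier)

lemma limR_carrier: "limR \<in> carrier_mat 1 (2 * n * (2 * n))"
  unfolding limR_def by (rule mat_carrier)

lemma col_limV: "col limV 0 = kron_vec (2 * n) (consensus_vec n) (consensus_vec n)"
  by (intro eq_vecI) (simp_all add: limV_def)

lemma limVR_index:
  assumes "q < 2 * n * (2 * n)" "s < 2 * n * (2 * n)"
  shows "(limV * limR) $$ (q,s) = kron_vec (2 * n) (consensus_vec n) (consensus_vec n) $ q / (real n)\<^sup>2"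
  using assms limV_carrier limR_carrier by (simp add: scalar_prod_def) (simp add: limV_def limR_def)

lemma A_limV: "A * limV = limV"
proof (intro eq_matI)
  fix q c assume "q < dim_row limV" "c < dim_col limV"
  then have q: "q < 2 * n * (2 * n)" and c: "c = 0" using limV_carrier by auto
  have "(A * limV) $$ (q,c) = (A *\<^sub>v kron_vec (2 * n) (consensus_vec n) (consensus_vec n)) $ q"
    using q c A_carrier limV_carrier by (simp add: col_limV)
  also have "\<dots> = (\<Sum>(j,i)\<in>E. p i j * kron_vec (2 * n) (consensus_vec n) (consensus_vec n) $ q)"
    unfolding A_mult_kron_vec[OF consensus_vec_carrier consensus_vec_carrier q]
    by (intro sum.cong) (auto simp: Mm_mult_consensus_vec edge_less)
  also have "\<dots> = kron_vec (2 * n) (consensus_vec n) (consensus_vec n) $ q"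
    using prob_sum by (simp add: case_prod_unfold sum_distrib_right[symmetric])
  finally show "(A * limV) $$ (q,c) = limV $$ (q,c)" using q c by (simp add: limV_def)
qed (use A_carrier limV_carrier in auto)

text \<open>Column \<open>s\<close> averages tensors of two stepped unit vectors. Steps preserve
  coordinate sums, so each tensor sums to 1, and so do the probabilities.\<close>

lemma A_col_sum:
  assumes s: "s < 2 * n * (2 * n)"
  shows "(\<Sum>q<2 * n * (2 * n). A $$ (q,s)) = 1"
proof -
  let ?N = "2 * n"
  let ?a = "unit_vec ?N (s div ?N) :: real vec" and ?b = "unit_vec ?N (s mod ?N) :: real vec"
  have "s div ?N < ?N" "s mod ?N < ?N" using s n_gt_1 by (auto simp: less_mult_imp_div_less)
  moreover have unit_sum: "(\<Sum>r<?N. unit_vec ?N t $ r) = (1 :: real)" if "t < ?N" for t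
    using that by simp
  ultimately have ab: "(\<Sum>r<?N. ?a $ r) = 1" "(\<Sum>r<?N. ?b $ r) = 1" by blast+
  have "A $$ (q,s) = (\<Sum>(j,i)\<in>E. p i j * kron_vec ?N (M j i *\<^sub>v ?a) (M j i *\<^sub>v ?b) $ q)" if q: "q < ?N * ?N" for q
  proof -
    have "A ^\<^sub>m 1 = A" using A_carrier by simp
    then have "A $$ (q,s) = moment (Suc 0) ?a ?b (q div ?N) (q mod ?N)"
      using pow_A_index[OF q s, of 1] by simp
    then show ?thesis unfolding moment_Suc by (simp only: moment_0 kron_vec_index[OF q])
  qed
  then have "(\<Sum>q<?N * ?N. A $$ (q,s)) =
      (\<Sum>q<?N * ?N. \<Sum>e\<in>E. p (snd e) (fst e) * kron_vec ?N (M (fst e) (snd e) *\<^sub>v ?a) (M (fst e) (snd e) *\<^sub>v ?b) $ q)"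
    by (intro sum.cong) (auto simp: case_prod_unfold)
  also have "\<dots> =
      (\<Sum>e\<in>E. \<Sum>q<?N * ?N. p (snd e) (fst e) * kron_vec ?N (M (fst e) (snd e) *\<^sub>v ?a) (M (fst e) (snd e) *\<^sub>v ?b) $ q)"
    by (rule sum.swap)
  also have "\<dots> = (\<Sum>e\<in>E. p (snd e) (fst e))"
  proof (intro sum.cong refl)
    fix e assume "e \<in> E"
    then have "fst e < n" "snd e < n" using edges by auto
    then have "(\<Sum>q<?N * ?N. kron_vec ?N (M (fst e) (snd e) *\<^sub>v ?a) (M (fst e) (snd e) *\<^sub>v ?b) $ q) = 1"
      unfolding sum_kron_vec by (simp only: sum_Mm_mult_vec unit_vec_carrier ab)
    then show "(\<Sum>q<?N * ?N. p (snd e) (fst e) * kron_vec ?N (M (fst e) (snd e) *\<^sub>v ?a) (M (fst e) (snd e) *\<^sub>v ?b) $ q)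
        = p (snd e) (fst e)"
      by (simp only: sum_distrib_left[symmetric])
  qed
  also have "\<dots> = 1" using prob_sum by (simp add: case_prod_unfold)
  finally show ?thesis .
qed

lemma limR_A: "limR * A = limR"
proof (intro eq_matI)
  fix c s assume "c < dim_row limR" "s < dim_col limR"
  then have s: "s < 2 * n * (2 * n)" and c: "c = 0" using limR_carrier by auto
  have "(limR * A) $$ (c,s) = (\<Sum>q<2 * n * (2 * n). limR $$ (0,q) * A $$ (q,s))"
    using s c A_carrier limR_carrier by (simp add: scalar_prod_def lessThan_atLeast0)
  also have "\<dots> = (\<Sum>q<2 * n * (2 * n). A $$ (q,s)) / (real n)\<^sup>2"
    unfolding sum_divide_distrib by (intro sum.cong) (auto simp: limR_def)
  also have "\<dots> = limR $$ (c,s)" using s c by (simp only: A_col_sum) (simp add: limR_def)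
  finally show "(limR * A) $$ (c,s) = limR $$ (c,s)" .
qed (use A_carrier limR_carrier in auto)

lemma limR_limV: "limR * limV = 1\<^sub>m 1"
proof (intro eq_matI)
  fix c d assume "c < dim_row (1\<^sub>m 1 :: real mat)" "d < dim_col (1\<^sub>m 1 :: real mat)"
  then have cd: "c = 0" "d = 0" by auto
  have "(limR * limV) $$ (0,0) = (\<Sum>q<2 * n * (2 * n). limR $$ (0,q) * limV $$ (q,0))"
    using limR_carrier limV_carrier by (simp add: scalar_prod_def lessThan_atLeast0)
  also have "\<dots> = (\<Sum>q<2 * n * (2 * n). kron_vec (2 * n) (consensus_vec n) (consensus_vec n) $ q) / (real n)\<^sup>2"
    unfolding sum_divide_distrib by (intro sum.cong) (auto simp: limR_def limV_def)
  also have "\<dots> = 1" unfolding sum_kron_vec sum_consensus_vec using n_gt_1 by (simp add: power2_eq_square)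
  finally show "(limR * limV) $$ (c,d) = 1\<^sub>m 1 $$ (c,d)" using cd by simp
qed (use limR_carrier limV_carrier in auto)

section \<open>Consensus errors as moments of the centred initial state\<close>

text \<open>Since runs along edges fix \<open>consensus_vec\<close>, centring the initial state once
  yields the error vector of the run at every later time.\<close>

definition dev :: "real vec \<Rightarrow> real vec" where
  "dev x0 = init n x0 + (- xavg n x0) \<cdot>\<^sub>v consensus_vec n"

lemma init_carrier: "dim_vec x0 = n \<Longrightarrow> init n x0 \<in> carrier_vec (2 * n)"
  by (intro carrier_vecI) (simp add: init_def)

lemma dev_carrier: "dim_vec x0 = n \<Longrightarrow> dev x0 \<in> carrier_vec (2 * n)"
  unfolding dev_def by (intro add_carrier_vec init_carrier smult_carrier_vec[THEN iffD2] consensus_vec_carrier)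

lemma init_index:
  assumes "dim_vec x0 = n" "a < 2 * n"
  shows "init n x0 $ a = (if a < n then x0 $ a else 0)"
  using assms by (auto simp: init_def)

lemma sum_dev:
  assumes "dim_vec x0 = n"
  shows "(\<Sum>a<2 * n. dev x0 $ a) = 0"
proof -
  have "dev x0 $ a = init n x0 $ a - xavg n x0 * consensus_vec n $ a" if "a < 2 * n" for a
    using that by (simp add: dev_def carrier_vecD[OF consensus_vec_carrier])
  then have "(\<Sum>a<2 * n. dev x0 $ a) = (\<Sum>a<n. x0 $ a) - real n * xavg n x0"
    using assms by (simp add: sum_lessThan_double init_index consensus_vec_index sum_subtractf)
  then show ?thesis using n_gt_1 by (simp add: xavg_def)
qed

lemma run_dev_index:
  assumes "dim_vec x0 = n" "es \<in> seqs E k" "a < 2 * n"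
  shows "run n w \<epsilon> es (dev x0) $ a = run n w \<epsilon> es (init n x0) $ a - (if a < n then xavg n x0 else 0)"
proof -
  have "run n w \<epsilon> es (dev x0) = run n w \<epsilon> es (init n x0) + (- xavg n x0) \<cdot>\<^sub>v consensus_vec n"
    unfolding dev_def using assms
    by (simp add: run_add init_carrier run_smult run_consensus_vec seqs_def)
  then show ?thesis
    using assms carrier_vecD[OF run_carrier[OF init_carrier]]
    by (simp add: carrier_vecD[OF consensus_vec_carrier] consensus_vec_index)
qed

text \<open>The squared norm splits into coordinates, and the run from \<open>dev x0\<close>
  supplies the centred values.\<close>

lemma Ex_err_eq:
  assumes x0: "dim_vec x0 = n"
  shows "Ex_err n E p w \<epsilon> x0 k = (\<Sum>a<n. moment k (dev x0) (dev x0) a a)"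
proof -
  have "Ex_err n E p w \<epsilon> x0 k = (\<Sum>es\<in>seqs E k. \<Sum>a<n. seq_prob p es *
      (run n w \<epsilon> es (dev x0) $ a * run n w \<epsilon> es (dev x0) $ a))"
    unfolding Ex_err_def sum_distrib_left[symmetric]
    by (intro sum.cong arg_cong2[of _ _ _ _ "(*)"] refl)
      (auto simp: sqnorm_def xpart_def run_dev_index[OF x0] power2_eq_square intro!: sum.cong)
  then show ?thesis unfolding moment_def by (subst sum.swap) 
qed

lemma Es_err_eq:
  assumes x0: "dim_vec x0 = n"
  shows "Es_err n E p w \<epsilon> x0 k = (\<Sum>a<n. moment k (dev x0) (dev x0) (n + a) (n + a))"
proof -
  have "Es_err n E p w \<epsilon> x0 k = (\<Sum>es\<in>seqs E k. \<Sum>a<n. seq_prob p es *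
      (run n w \<epsilon> es (dev x0) $ (n + a) * run n w \<epsilon> es (dev x0) $ (n + a)))"
    unfolding Es_err_def sum_distrib_left[symmetric]
    by (intro sum.cong arg_cong2[of _ _ _ _ "(*)"] refl)
      (auto simp: sqnorm_def spart_def run_dev_index[OF x0] power2_eq_square intro!: sum.cong)
  then show ?thesis unfolding moment_def by (subst sum.swap)
qed

text \<open>The two errors collect the diagonal moments of the upper and the lower half of the
  state, and these are nonnegative.\<close>

lemma ms_consensus_iff_decays:
  "ms_consensus n E p w \<epsilon> \<longleftrightarrow> (\<forall>x0. dim_vec x0 = n \<longrightarrow> decays (dev x0))"
proof -
  have "(Ex_err n E p w \<epsilon> x0 \<longlonglongrightarrow> 0) \<and> (Es_err n E p w \<epsilon> x0 \<longlonglongrightarrow> 0) \<longleftrightarrow> decays (dev x0)"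
    if x0: "dim_vec x0 = n" for x0
  proof -
    let ?m = "\<lambda>a k. moment k (dev x0) (dev x0) a a"
    have "(Ex_err n E p w \<epsilon> x0 \<longlonglongrightarrow> 0) \<longleftrightarrow> (\<forall>a\<in>{..<n}. ?m a \<longlonglongrightarrow> 0)"
      unfolding Ex_err_eq[OF x0, abs_def] by (rule tendsto_sum_nonneg_0_iff) (auto simp: moment_nonneg)
    moreover have "(Es_err n E p w \<epsilon> x0 \<longlonglongrightarrow> 0) \<longleftrightarrow> (\<forall>a\<in>{..<n}. ?m (n + a) \<longlonglongrightarrow> 0)"
      unfolding Es_err_eq[OF x0, abs_def] by (rule tendsto_sum_nonneg_0_iff) (auto simp: moment_nonneg)
    moreover have "decays (dev x0) \<longleftrightarrow> (\<forall>a\<in>{..<n}. ?m a \<longlonglongrightarrow> 0) \<and> (\<forall>a\<in>{..<n}. ?m (n + a) \<longlonglongrightarrow> 0)"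
      unfolding decays_def by (auto elim!: less_doubleE)
    ultimately show ?thesis by blast
  qed
  then show ?thesis by (auto simp: ms_consensus_def)
qed

section \<open>From convergence of the powers to decay\<close>

text \<open>The limit of the moment is an entry of \<open>limV * limR\<close> applied to the tensor
  square of \<open>z\<close>. There \<open>limR\<close> produces a multiple of the squared
  coordinate sum of \<open>z\<close>, which is 0.\<close>

lemma decays_of_pow_A_tendsto:
  assumes lim: "\<forall>q<2 * n * (2 * n). \<forall>s<2 * n * (2 * n). (\<lambda>k. (A ^\<^sub>m k) $$ (q,s)) \<longlonglongrightarrow> (limV * limR) $$ (q,s)"
    and z: "z \<in> carrier_vec (2 * n)" and sum0: "(\<Sum>a<2 * n. z $ a) = 0"
  shows "decays z"
  unfolding decays_def
proof (intro allI impI)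
  fix r assume r: "r < 2 * n"
  \<comment> \<open>\<open>?q\<close> is the row-major number of the pair of \<open>r\<close> with
    itself.\<close>
  let ?N = "2 * n" and ?q = "r * (2 * n) + r"
  have q: "?q < ?N * ?N"
  proof -
    have "?q < Suc r * ?N" using r by simp
    also have "\<dots> \<le> ?N * ?N" using r by (intro mult_le_mono1) simp
    finally show ?thesis .
  qed
  have qdm: "?q div ?N = r" "?q mod ?N = r" using r by auto
  have "moment k z z r r = (\<Sum>s<?N * ?N. (A ^\<^sub>m k) $$ (?q,s) * kron_vec ?N z z $ s)" for k
    using pow_A_mult_kron_vec[OF z z q, of k] unfolding qdm
      mult_mat_vec_index_sum[OF pow_carrier_mat[OF A_carrier] kron_vec_carrier q] by simp
  moreover have "(\<lambda>k. \<Sum>s<?N * ?N. (A ^\<^sub>m k) $$ (?q,s) * kron_vec ?N z z $ s) \<longlonglongrightarrow>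
      (\<Sum>s<?N * ?N. (limV * limR) $$ (?q,s) * kron_vec ?N z z $ s)"
    using lim q by (intro tendsto_sum tendsto_mult_right) auto
  moreover have "(\<Sum>s<?N * ?N. (limV * limR) $$ (?q,s) * kron_vec ?N z z $ s) =
      kron_vec ?N (consensus_vec n) (consensus_vec n) $ ?q / (real n)\<^sup>2 * (\<Sum>s<?N * ?N. kron_vec ?N z z $ s)"
    unfolding sum_distrib_left using q by (intro sum.cong refl) (simp only: limVR_index lessThan_iff)
  moreover have "(\<Sum>s<?N * ?N. kron_vec ?N z z $ s) = 0" unfolding sum_kron_vec sum0 by simp
  ultimately show "(\<lambda>k. moment k z z r r) \<longlonglongrightarrow> 0" by simp
qed

section \<open>From consensus to convergence of the powers\<close>

text \<open>A step along an edge into \<open>l\<close> alters the upper half only at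
  \<open>l\<close>, so this coordinate keeps its initial value in every run.\<close>

lemma moment_no_in_edge:
  assumes "\<And>j. (j,i) \<notin> E" "i < n" "z \<in> carrier_vec (2 * n)"
  shows "moment k z z i i = z $ i * z $ i"
  using assms(3)
proof (induction k arbitrary: z)
  case (Suc k)
  have "moment (Suc k) z z i i = (\<Sum>(j,l)\<in>E. p l j * (z $ i * z $ i))"
    unfolding moment_Suc
  proof (intro sum.cong refl, clarify)
    fix j l assume e: "(j,l) \<in> E"
    then have "l \<noteq> i" using assms(1) by auto
    then show "p l j * moment k (M j l *\<^sub>v z) (M j l *\<^sub>v z) i i = p l j * (z $ i * z $ i)"
      using Suc.IH[OF M_mult_carrier] Mm_mult_vec(1)[OF Suc.prems edge_less[OF e] assms(2)] by simp
  qed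
  then show ?case
    using prob_sum by (simp add: case_prod_unfold sum_distrib_right[symmetric])
qed simp

text \<open>Otherwise the start at the unit vector of \<open>i\<close> would keep the error
  \<open>1 - 1 / n\<close> at \<open>i\<close> forever, which is nonzero for
  \<open>n > 1\<close>.\<close>

lemma ex_in_edge:
  assumes cons: "\<And>x0. dim_vec x0 = n \<Longrightarrow> decays (dev x0)" and i: "i < n"
  shows "\<exists>j. (j,i) \<in> E"
proof (rule ccontr)
  assume "\<nexists>j. (j,i) \<in> E"
  then have no: "\<And>j. (j,i) \<notin> E" by blast
  let ?x = "unit_vec n i :: real vec"
  have "(\<lambda>k. moment k (dev ?x) (dev ?x) i i) \<longlonglongrightarrow> 0"
    using cons[of ?x] i by (auto simp: decays_def)
  then have "dev ?x $ i * dev ?x $ i = 0"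
    unfolding moment_no_in_edge[OF no i dev_carrier[of ?x, simplified]] by (simp add: LIMSEQ_const_iff)
  moreover have "dev ?x $ i = 1 - 1 / real n"
    using i by (simp add: dev_def carrier_vecD[OF consensus_vec_carrier] consensus_vec_index init_index xavg_def)
  ultimately show False using n_gt_1 by simp
qed

text \<open>Starting from \<open>s(0) = 0\<close>, one step along an edge into \<open>i\<close> moves mass from
  \<open>x\<^sub>i\<close> to \<open>s\<^sub>i\<close>; this is how decay for \<open>s(0) = 0\<close> extends to arbitrary initial surpluses.\<close>
lemma decays_transfer:
  assumes cons: "\<And>x0. dim_vec x0 = n \<Longrightarrow> decays (dev x0)" and i: "i < n"
  shows "decays (unit_vec (2 * n) (n + i) + (-1) \<cdot>\<^sub>v unit_vec (2 * n) i)"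
proof -
  obtain j where e: "(j,i) \<in> E" using ex_in_edge[OF cons i] by blast
  have ji: "j < n" "j \<noteq> i" using edge_less[OF e] no_loops e by auto
  have w: "w i j > 0" using weight e by auto
  define u where "u = dev (unit_vec n i)"
  have u: "u \<in> carrier_vec (2 * n)" "decays u" unfolding u_def by (auto intro: dev_carrier cons)
  have u_index: "u $ a = (if a = i then 1 else 0) - (if a < n then 1 / real n else 0)" if "a < 2 * n" for a
    using that i by (auto simp: u_def dev_def carrier_vecD[OF consensus_vec_carrier] consensus_vec_index init_index xavg_def)
  \<comment> \<open>In \<open>u\<close> the values at \<open>i\<close> and \<open>j\<close> differ
    by exactly 1 and all surpluses are 0. The step therefore moves mass \<open>w i j\<close> from
    coordinate \<open>i\<close> to \<open>n + i\<close>; dividing the increment by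
    \<open>w i j\<close> leaves the difference of unit vectors.\<close>
  let ?y = "(1 / w i j) \<cdot>\<^sub>v (M j i *\<^sub>v u + (-1) \<cdot>\<^sub>v u)"
  have "decays ?y"
    by (intro decays_smult decays_add decays_M_mult add_carrier_vec smult_carrier_vec[THEN iffD2] u e M_mult_carrier)
  also have "?y = unit_vec (2 * n) (n + i) + (-1) \<cdot>\<^sub>v unit_vec (2 * n) i"
  proof (intro eq_vecI)
    fix a assume "a < dim_vec (unit_vec (2 * n) (n + i) + (-1) \<cdot>\<^sub>v unit_vec (2 * n) i :: real vec)"
    then have a: "a < 2 * n" by simp
    then show "?y $ a = (unit_vec (2 * n) (n + i) + (-1) \<cdot>\<^sub>v unit_vec (2 * n) i) $ a"
      using w u(1) i ji
      by (elim less_doubleE)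
        (auto simp: Mm_mult_vec u_index carrier_vecD[OF M_mult_carrier] carrier_vecD[OF u(1)]
          simp del: index_mult_mat_vec dim_mult_mat_vec)
  qed (use u in auto)
  finally show ?thesis .
qed

text \<open>For \<open>a\<close> in the upper half this is \<open>dev\<close> of a unit vector; a
  lower coordinate is reached by adding the vector of \<open>decays_transfer\<close>.\<close>

lemma decays_unit:
  assumes cons: "\<And>x0. dim_vec x0 = n \<Longrightarrow> decays (dev x0)" and a: "a < 2 * n"
  shows "decays (unit_vec (2 * n) a + (- 1 / real n) \<cdot>\<^sub>v consensus_vec n)"
proof -
  have upper: "decays (unit_vec (2 * n) b + (- 1 / real n) \<cdot>\<^sub>v consensus_vec n)" if "b < n" for b
  proof -
    have "dev (unit_vec n b) = unit_vec (2 * n) b + (- 1 / real n) \<cdot>\<^sub>v consensus_vec n"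
      unfolding dev_def using that
      by (intro arg_cong2[of _ _ _ _ "(+)"] eq_vecI) (auto simp: init_index xavg_def init_def)
    then show ?thesis using cons[of "unit_vec n b"] by simp
  qed
  from a show ?thesis
  proof (cases rule: less_doubleE)
    case 1
    then show ?thesis by (rule upper)
  next
    case (2 b)
    let ?g = "unit_vec (2 * n) (n + b) + (-1) \<cdot>\<^sub>v unit_vec (2 * n) b :: real vec"
    let ?f = "unit_vec (2 * n) b + (- 1 / real n) \<cdot>\<^sub>v consensus_vec n"
    have "decays (?g + ?f)"
      using 2 by (intro decays_add[OF _ _ decays_transfer[OF cons] upper]) auto
    also have "?g + ?f = unit_vec (2 * n) a + (- 1 / real n) \<cdot>\<^sub>v consensus_vec n"
      by (intro eq_vecI) (auto simp: 2 carrier_vecD[OF consensus_vec_carrier])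
    finally show ?thesis .
  qed
qed

text \<open>Each unit vector is a decaying vector plus \<open>1 / n\<close> times
  \<open>consensus_vec\<close>. Bilinear expansion of the moment leaves only the pure consensus
  term, which is constant in \<open>k\<close> and equals the entry of the limit.\<close>

lemma pow_A_tendsto_of_decays:
  assumes cons: "\<And>x0. dim_vec x0 = n \<Longrightarrow> decays (dev x0)"
    and q: "q < 2 * n * (2 * n)" and s: "s < 2 * n * (2 * n)"
  shows "(\<lambda>k. (A ^\<^sub>m k) $$ (q,s)) \<longlonglongrightarrow> (limV * limR) $$ (q,s)"
proof -
  let ?N = "2 * n"
  define r c where "r = q div ?N" and "c = q mod ?N"
  define t where "t = 1 / real n"
  define d where "d = (\<lambda>a. unit_vec ?N a + (- t) \<cdot>\<^sub>v consensus_vec n)"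
  define a b where "a = s div ?N" and "b = s mod ?N"
  have lt: "r < ?N" "c < ?N" "a < ?N" "b < ?N"
    using q s n_gt_1 by (auto simp: r_def c_def a_def b_def less_mult_imp_div_less)
  have dc: "d a \<in> carrier_vec ?N" for a by (simp add: d_def)
  have unit: "unit_vec ?N a = d a + t \<cdot>\<^sub>v consensus_vec n" for a
    by (intro eq_vecI) (auto simp: d_def carrier_vecD[OF consensus_vec_carrier])
  have dd: "(\<lambda>k. moment k (d a) (d a) r r) \<longlonglongrightarrow> 0" if "a < ?N" "r < ?N" for a r
    using decays_unit[OF cons that(1)] that(2) by (simp add: decays_def d_def t_def)
  have cc: "(\<lambda>k. moment k (consensus_vec n) (consensus_vec n) r r) \<longlonglongrightarrow> consensus_vec n $ r * consensus_vec n $ r" for r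
    by (simp add: moment_consensus_vec)
  have eq: "(A ^\<^sub>m k) $$ (q,s) = moment k (d a) (d b) r c + t * moment k (d a) (consensus_vec n) r c
      + (t * moment k (consensus_vec n) (d b) r c + t * (t * (consensus_vec n $ r * consensus_vec n $ c)))" for k
    unfolding pow_A_index[OF q s] r_def[symmetric] c_def[symmetric] a_def[symmetric] b_def[symmetric] unit
    using lt dc
    by (simp add: moment_add_left moment_add_right moment_smult_left moment_smult_right moment_consensus_vec distrib_left)
  have "(\<lambda>k. (A ^\<^sub>m k) $$ (q,s)) \<longlonglongrightarrow> 0 + t * 0 + (t * 0 + t * (t * (consensus_vec n $ r * consensus_vec n $ c)))"
    \<comment> \<open>The third term is commuted so that the decaying vector comes first in
      \<open>moment_tendsto_0\<close>.\<close>
    unfolding eq moment_commute[of _ "consensus_vec n" "d b"]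
    by (intro tendsto_add tendsto_mult_left tendsto_const moment_tendsto_0[OF dd dd] moment_tendsto_0[OF dd cc] lt)
  also have "0 + t * 0 + (t * 0 + t * (t * (consensus_vec n $ r * consensus_vec n $ c))) = (limV * limR) $$ (q,s)"
    unfolding limVR_index[OF q s] kron_vec_index[OF q] r_def[symmetric] c_def[symmetric]
    by (simp add: t_def power2_eq_square)
  finally show ?thesis .
qed

theorem ms_consensus_iff:
  "ms_consensus n E p w \<epsilon> \<longleftrightarrow>
    (let A = map_mat complex_of_real (EMM n E p w \<epsilon>) in
       eigenvalue A 1 \<and> Polynomial.order 1 (char_poly A) = 1 \<and>
       (\<forall>z. eigenvalue A z \<and> z \<noteq> 1 \<longrightarrow> cmod z < 1))"
proof -
  have "ms_consensus n E p w \<epsilon> \<longleftrightarrow> (\<forall>q<2 * n * (2 * n). \<forall>s<2 * n * (2 * n).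
      (\<lambda>k. (A ^\<^sub>m k) $$ (q,s)) \<longlonglongrightarrow> (limV * limR) $$ (q,s))"
    unfolding ms_consensus_iff_decays
    using pow_A_tendsto_of_decays decays_of_pow_A_tendsto dev_carrier sum_dev by blast
  also note real_pow_mat_tendsto_rank_one_iff[OF A_carrier limV_carrier limR_carrier A_limV limR_A limR_limV]
  finally show ?thesis .
qed

end

theorem proposition3:
  fixes n :: nat and E :: "(nat \<times> nat) set" and p w :: "nat \<Rightarrow> nat \<Rightarrow> real" and \<epsilon> :: real
  assumes "n > 1"
    and "E \<subseteq> {0..<n} \<times> {0..<n}"
    and "\<forall>(j,i)\<in>E. j \<noteq> i"
    and "\<forall>(j,i)\<in>E. 0 < p i j \<and> p i j < 1"
    and "(\<Sum>(j,i)\<in>E. p i j) = 1"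
    and "\<forall>(j,i)\<in>E. 0 < w i j \<and> w i j < 1"
    and "\<epsilon> > 0"
  shows "ms_consensus n E p w \<epsilon> \<longleftrightarrow>
    (let A = map_mat complex_of_real (EMM n E p w \<epsilon>) in
       eigenvalue A 1 \<and> order 1 (char_poly A) = 1 \<and>
       (\<forall>z. eigenvalue A z \<and> z \<noteq> 1 \<longrightarrow> cmod z < 1))"
proof -
  interpret gossip n E p w \<epsilon>
    using assms by unfold_locales
  show ?thesis by (rule ms_consensus_iff)
qed

end
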